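(* Let $V$ be a real Euclidean space of dimension $n$ with inner product $(\cdot,\cdot)$, let $\Phi\subset V$ be a root system spanning $V$ with finite Weyl group $W$, simple roots $\Delta=\{\alpha_1,\dots,\alpha_n\}$ and positive roots $\Phi^+$. Let $\mathcal{G}$ be a $W$-invariant building set associated with $\Phi$ with $V\in\mathcal{G}$, and fix a suitable list $\epsilon_1<\dots<\epsilon_n=a$. Then the polytope \[P_{\mathcal{G}_{fund}}:=H_V\cap\bigcap_{A\in\mathcal{G}_{fund}\setminus\{V\}}HS_A\] is a realization of the nestohedron associated with $\mathcal{G}_{fund}$, i.e. there is an inclusion-reversing bijection between the nonempty faces of $P_{\mathcal{G}_{fund}}$ and the $\mathcal{G}_{fund}$-nested sets containing $V$ (ordered by inclusion), under which faces of dimension $i$ correspond to nested sets of cardinality $n-i$. Moreover $P_{\mathcal{G}_{fund}}$ lies in the open fundamental chamber $\{x\in V:(x,\alpha_i)>0\ \forall i\}$, and its vertices are exactly the points $v_{\mathcal{S}}$ where $\mathcal{S}$ ranges over the maximal $\mathcal{G}_{fund}$-nested sets.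
   Context: Notation. $\omega_1,\dots,\omega_n$ are the fundamental weights: $2(\alpha_i,\omega_j)/(\alpha_i,\alpha_i)=\delta_{ij}$. For a subspace $A$ spanned by roots, $\pi_A=\frac12\sum_{\alpha\in\Phi^+\cap A}\alpha$ (the sum over irreducible components of $\Phi\cap A$ of the half-sums of their positive roots); $\delta=\pi_V$; for $A\neq V$, $\delta_A=\delta-\pi_A$, and $\delta_V=\delta$. $\mathcal{C}_\Phi$ is the set of subspaces of $V$ spanned by nonempty subsets of $\Phi$. A building set is $\mathcal{G}\subseteq\mathcal{C}_\Phi$ containing every line $\langle\alpha\rangle$, $\alpha\in\Phi$, such that every $C\in\mathcal{C}_\Phi$ is the direct sum of the maximal elements of $\mathcal{G}$ contained in $C$. $\mathcal{G}_{fund}$ is the set of elements of $\mathcal{G}$ spanned by a subset of $\Delta$. A subset $\mathcal{S}\subseteq\mathcal{G}_{fund}$ is nested if for every $h\ge2$ pairwise inclusion-incomparable $U_1,\dots,U_h\in\mathcal{S}$, $U_1+\dots+U_h\notin\mathcal{G}$; maximal nested means maximal under inclusion. Suitable list. For $B\subsetneq A$ in $\mathcal{G}_{fund}$, write $\pi_A,\pi_B$ as nonnegative combinations of simple roots; let $p$ be the maximal coefficient of $\pi_A$ and $q$ the minimal coefficient of $\pi_B$ among the simple roots lying in $B$; $R^A_B=p/q$. For $j<i$, $R^i_j$ is the maximum of $R^A_B$ over all such pairs with $\dim A=i$, $\dim B=j$. A suitable list is a list of reals $0<\epsilon_1<\epsilon_2<\dots<\epsilon_n=a$ with $\epsilon_i>2R^i_{i-1}\epsilon_{i-1}$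 for $i=2,\dots,n$. Hyperplanes. $H_V=\{x:(x,\delta)=a\}$; for $A\in\mathcal{G}_{fund}\setminus\{V\}$, $H_A=\{x:(x,\delta_A)=a-\epsilon_{\dim A}\}$ and $HS_A$ is the closed half-space bounded by $H_A$ containing the origin, i.e. $\{x:(x,\delta_A)\le a-\epsilon_{\dim A}\}$. For $\mathcal{T}\subseteq\mathcal{G}_{fund}$ with $V\in\mathcal{T}$, $|\mathcal{T}|=n$ and $\{\delta_A:A\in\mathcal{T}\}$ linearly independent, $v_{\mathcal{T}}$ is the unique point of $\bigcap_{A\in\mathcal{T}}H_A$.
   Formalization: In the definition of a suitable list, when there is no pair B ⊊ A in G_fund with dim A = i and dim B = i−1, the maximum R^i_{i−1} is undefined; it is read as 1, so the condition becomes ε_i > 2ε_{i−1}. *)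

theory Defs
  imports "HOL-Analysis.Analysis"
begin

text \<open>
  The space \<open>V\<close> is the whole type \<open>'a :: euclidean_space\<close>, that is \<open>UNIV\<close>, and
  \<open>n = DIM('a)\<close>.
\<close>

subsection \<open>Root systems\<close>

definition root_reflection :: "'a::real_inner \<Rightarrow> 'a \<Rightarrow> 'a" where
  "root_reflection \<alpha> x = x - (2 * (x \<bullet> \<alpha>) / (\<alpha> \<bullet> \<alpha>)) *\<^sub>R \<alpha>"

text \<open>
  Finite reduced root systems in the sense of Coxeter groups. Integrality of
  \<open>2 (\<alpha>, \<beta>) / (\<alpha>, \<alpha>)\<close> is not required, so crystallographic root systems are a special case.
\<close>

definition root_system :: "'a::euclidean_space set \<Rightarrow> bool" where
  "root_system \<Phi> \<longleftrightarrow>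
     finite \<Phi> \<and> 0 \<notin> \<Phi> \<and> span \<Phi> = UNIV \<and>
     (\<forall>\<alpha>\<in>\<Phi>. \<Phi> \<inter> span {\<alpha>} = {\<alpha>, - \<alpha>}) \<and>
     (\<forall>\<alpha>\<in>\<Phi>. root_reflection \<alpha> ` \<Phi> = \<Phi>)"

text \<open>Reflections are involutions, so closure under inverses need not be imposed.\<close>

inductive_set weyl_group :: "'a::euclidean_space set \<Rightarrow> ('a \<Rightarrow> 'a) set"
  for \<Phi> :: "'a set" where
  weyl_id: "id \<in> weyl_group \<Phi>"
| weyl_step: "w \<in> weyl_group \<Phi> \<Longrightarrow> \<alpha> \<in> \<Phi> \<Longrightarrow> root_reflection \<alpha> \<circ> w \<in> weyl_group \<Phi>"

text \<open>
  For a basis \<open>\<Delta>\<close>, \<^term>\<open>representation \<Delta> x \<alpha>\<close> is the coefficient of \<open>\<alpha> \<in> \<Delta>\<close> in the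
  expansion of \<open>x\<close>.
\<close>

definition simple_roots :: "'a::euclidean_space set \<Rightarrow> 'a set \<Rightarrow> bool" where
  "simple_roots \<Phi> \<Delta> \<longleftrightarrow>
     \<Delta> \<subseteq> \<Phi> \<and> independent \<Delta> \<and> span \<Delta> = UNIV \<and>
     (\<forall>\<beta>\<in>\<Phi>. (\<forall>\<alpha>\<in>\<Delta>. 0 \<le> representation \<Delta> \<beta> \<alpha>) \<or> (\<forall>\<alpha>\<in>\<Delta>. representation \<Delta> \<beta> \<alpha> \<le> 0))"

definition positive_roots :: "'a::euclidean_space set \<Rightarrow> 'a set \<Rightarrow> 'a set" where
  "positive_roots \<Phi> \<Delta> = {\<beta> \<in> \<Phi>. \<forall>\<alpha>\<in>\<Delta>. 0 \<le> representation \<Delta> \<beta> \<alpha>}"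

definition fundamental_chamber :: "'a::euclidean_space set \<Rightarrow> 'a set" where
  "fundamental_chamber \<Delta> = {x. \<forall>\<alpha>\<in>\<Delta>. 0 < x \<bullet> \<alpha>}"

text \<open>\<open>\<pi>\<^sub>A\<close>\<close>

definition half_sum :: "'a::euclidean_space set \<Rightarrow> 'a set \<Rightarrow> 'a set \<Rightarrow> 'a" where
  "half_sum \<Phi> \<Delta> A = (1 / 2) *\<^sub>R (\<Sum>\<alpha> \<in> positive_roots \<Phi> \<Delta> \<inter> A. \<alpha>)"

text \<open>\<open>\<delta>\<^sub>A\<close>; in particular \<open>\<delta> = \<delta>\<^sub>V\<close>\<close>

definition delta :: "'a::euclidean_space set \<Rightarrow> 'a set \<Rightarrow> 'a set \<Rightarrow> 'a" where
  "delta \<Phi> \<Delta> A =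
     (if A = UNIV then half_sum \<Phi> \<Delta> UNIV else half_sum \<Phi> \<Delta> UNIV - half_sum \<Phi> \<Delta> A)"


subsection \<open>Building sets and nested sets\<close>

definition root_subspaces :: "'a::euclidean_space set \<Rightarrow> 'a set set" where
  "root_subspaces \<Phi> = {span S | S. S \<subseteq> \<Phi> \<and> S \<noteq> {}}"

text \<open>
  For a finite family \<open>M\<close> of subspaces, \<open>C\<close> is the (internal) direct sum of the members of \<open>M\<close>
  iff the addition map from their product is a bijection onto \<open>C\<close>.
\<close>

definition direct_sum_of :: "'a::euclidean_space set \<Rightarrow> 'a set set \<Rightarrow> bool" where
  "direct_sum_of C M \<longleftrightarrow> bij_betw (\<lambda>f. \<Sum>U\<in>M. f U) (PiE M (\<lambda>U. U)) C"

definition maximal_in :: "'a set set \<Rightarrow> 'a set \<Rightarrow> 'a set set" where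
  "maximal_in G C = {U \<in> G. U \<subseteq> C \<and> (\<forall>U'\<in>G. U' \<subseteq> C \<longrightarrow> U \<subseteq> U' \<longrightarrow> U' = U)}"

definition building_set :: "'a::euclidean_space set \<Rightarrow> 'a set set \<Rightarrow> bool" where
  "building_set \<Phi> G \<longleftrightarrow>
     G \<subseteq> root_subspaces \<Phi> \<and> (\<forall>\<alpha>\<in>\<Phi>. span {\<alpha>} \<in> G) \<and>
     (\<forall>C\<in>root_subspaces \<Phi>. direct_sum_of C (maximal_in G C))"

definition weyl_invariant :: "'a::euclidean_space set \<Rightarrow> 'a set set \<Rightarrow> bool" where
  "weyl_invariant \<Phi> G \<longleftrightarrow> (\<forall>w\<in>weyl_group \<Phi>. \<forall>A\<in>G. w ` A \<in> G)"

definition fund :: "'a::euclidean_space set \<Rightarrow> 'a set set \<Rightarrow> 'a set set" where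
  "fund \<Delta> G = {A \<in> G. \<exists>S\<subseteq>\<Delta>. A = span S}"

text \<open>\<^term>\<open>span (\<Union>T)\<close> is the sum \<open>U\<^sub>1 + \<dots> + U\<^sub>h\<close> of the subspaces in \<open>T\<close>.\<close>

definition nested :: "'a::euclidean_space set \<Rightarrow> 'a set set \<Rightarrow> 'a set set \<Rightarrow> bool" where
  "nested \<Delta> G S \<longleftrightarrow>
     S \<subseteq> fund \<Delta> G \<and>
     (\<forall>T\<subseteq>S. finite T \<and> 2 \<le> card T \<and> (\<forall>U\<in>T. \<forall>U'\<in>T. U \<subseteq> U' \<longrightarrow> U = U')
        \<longrightarrow> span (\<Union>T) \<notin> G)"

definition maximal_nested :: "'a::euclidean_space set \<Rightarrow> 'a set set \<Rightarrow> 'a set set \<Rightarrow> bool" where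
  "maximal_nested \<Delta> G S \<longleftrightarrow>
     nested \<Delta> G S \<and> (\<forall>T. nested \<Delta> G T \<longrightarrow> S \<subseteq> T \<longrightarrow> T = S)"


subsection \<open>Suitable lists\<close>

text \<open>\<open>R\<^sup>A\<^sub>B = p / q\<close>\<close>

definition coeff_ratio ::
    "'a::euclidean_space set \<Rightarrow> 'a set \<Rightarrow> 'a set \<Rightarrow> 'a set \<Rightarrow> real" where
  "coeff_ratio \<Phi> \<Delta> A B =
     Max (representation \<Delta> (half_sum \<Phi> \<Delta> A) ` \<Delta>) /
     Min (representation \<Delta> (half_sum \<Phi> \<Delta> B) ` (\<Delta> \<inter> B))"

definition coeff_ratios ::
    "'a::euclidean_space set \<Rightarrow> 'a set \<Rightarrow> 'a set set \<Rightarrow> nat \<Rightarrow> nat \<Rightarrow> real set" where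
  "coeff_ratios \<Phi> \<Delta> G i j =
     {coeff_ratio \<Phi> \<Delta> A B | A B.
        A \<in> fund \<Delta> G \<and> B \<in> fund \<Delta> G \<and> B \<subset> A \<and> dim A = i \<and> dim B = j}"

text \<open>
  \<open>R\<^sup>i\<^sub>j\<close>. It can happen that \<open>G\<close> has no pair \<open>B \<subset> A\<close> of fundamental elements in dimensions
  \<open>j < i\<close> (for instance when \<open>G\<close> consists of \<open>V\<close> and the root lines of \<open>A\<^sub>1 \<times> A\<^sub>1 \<times> A\<^sub>1\<close>). The
  maximum over the empty set is then read as \<open>1\<close>, which is a lower bound for every
  ratio \<open>R\<^sup>A\<^sub>B\<close>.
\<close>

definition max_ratio ::
    "'a::euclidean_space set \<Rightarrow> 'a set \<Rightarrow> 'a set set \<Rightarrow> nat \<Rightarrow> nat \<Rightarrow> real" where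
  "max_ratio \<Phi> \<Delta> G i j =
     (if coeff_ratios \<Phi> \<Delta> G i j = {} then 1 else Max (coeff_ratios \<Phi> \<Delta> G i j))"

text \<open>The list \<open>\<epsilon>\<^sub>1, \<dots>, \<epsilon>\<^sub>n\<close> is a function on \<open>nat\<close> whose values outside \<open>{1..n}\<close> are irrelevant.\<close>

definition suitable_list ::
    "'a::euclidean_space set \<Rightarrow> 'a set \<Rightarrow> 'a set set \<Rightarrow> (nat \<Rightarrow> real) \<Rightarrow> real \<Rightarrow> bool" where
  "suitable_list \<Phi> \<Delta> G \<epsilon> a \<longleftrightarrow>
     0 < \<epsilon> 1 \<and> strict_mono_on {1..DIM('a)} \<epsilon> \<and> \<epsilon> (DIM('a)) = a \<and>
     (\<forall>i\<in>{2..DIM('a)}. \<epsilon> i > 2 * max_ratio \<Phi> \<Delta> G i (i - 1) * \<epsilon> (i - 1))"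


subsection \<open>The polytope\<close>

definition face_hyperplane ::
    "'a::euclidean_space set \<Rightarrow> 'a set \<Rightarrow> (nat \<Rightarrow> real) \<Rightarrow> real \<Rightarrow> 'a set \<Rightarrow> 'a set" where
  "face_hyperplane \<Phi> \<Delta> \<epsilon> a A =
     (if A = UNIV then {x. x \<bullet> delta \<Phi> \<Delta> UNIV = a}
      else {x. x \<bullet> delta \<Phi> \<Delta> A = a - \<epsilon> (dim A)})"

definition face_halfspace ::
    "'a::euclidean_space set \<Rightarrow> 'a set \<Rightarrow> (nat \<Rightarrow> real) \<Rightarrow> real \<Rightarrow> 'a set \<Rightarrow> 'a set" where
  "face_halfspace \<Phi> \<Delta> \<epsilon> a A = {x. x \<bullet> delta \<Phi> \<Delta> A \<le> a - \<epsilon> (dim A)}"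

definition fund_polytope ::
    "'a::euclidean_space set \<Rightarrow> 'a set \<Rightarrow> 'a set set \<Rightarrow> (nat \<Rightarrow> real) \<Rightarrow> real \<Rightarrow> 'a set" where
  "fund_polytope \<Phi> \<Delta> G \<epsilon> a =
     face_hyperplane \<Phi> \<Delta> \<epsilon> a UNIV \<inter>
     (\<Inter>A \<in> fund \<Delta> G - {UNIV}. face_halfspace \<Phi> \<Delta> \<epsilon> a A)"

text \<open>
  Only meaningful when the intersection is a single point, as is the case for \<open>V \<in> T\<close>, \<open>|T| = n\<close>
  and \<open>{\<delta>\<^sub>A : A \<in> T}\<close> linearly independent.
\<close>

definition hyperplane_point ::
    "'a::euclidean_space set \<Rightarrow> 'a set \<Rightarrow> (nat \<Rightarrow> real) \<Rightarrow> real \<Rightarrow> 'a set set \<Rightarrow> 'a" where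
  "hyperplane_point \<Phi> \<Delta> \<epsilon> a T = (THE x. x \<in> (\<Inter>A\<in>T. face_hyperplane \<Phi> \<Delta> \<epsilon> a A))"

definition nonempty_faces :: "'a::euclidean_space set \<Rightarrow> 'a set set" where
  "nonempty_faces P = {F. F face_of P \<and> F \<noteq> {}}"

definition nested_sets_with_top :: "'a::euclidean_space set \<Rightarrow> 'a set set \<Rightarrow> 'a set set set" where
  "nested_sets_with_top \<Delta> G = {S. nested \<Delta> G S \<and> UNIV \<in> S}"

end

theory Submission
  imports Defs
begin

text \<open>
  On \<open>H\<^sub>V\<close> the inequality of \<open>A\<close> reads \<open>(x, \<pi>\<^sub>A) \<ge> \<epsilon>\<^bsub>dim A\<^esub>\<close>; the inequalities of the root lines already force
  \<open>x\<close> into the open chamber. Suitability yields the key inequality: if \<open>(x, \<pi>\<^sub>K) \<le> \<epsilon>\<^bsub>dim K\<^esub>\<close> for all \<open>K\<close>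
  in a family whose sum \<open>A\<close> is a further member of the building set, then \<open>(x, \<pi>\<^sub>A) < \<epsilon>\<^bsub>dim A\<^esub>\<close> for every
  \<open>x\<close> in the chamber. Hence the set of constraints tight at a point of the polytope is nested. Conversely,
  the vectors \<open>\<pi>\<^sub>A\<close> of a maximal nested set form a basis; the common point of their hyperplanes lies
  in the chamber, and it satisfies all other inequalities strictly, since among the violated ones
  a largest would contradict the key inequality. Moving away from such a vertex along the dual
  basis realizes every nested set containing \<open>V\<close> as the exact set of tight constraints of a point,
  and a face is determined by the constraints that are tight on all of it.
\<close>

subsection \<open>Nested families of a finite building set\<close>

text \<open>The difficulty lies in the key inequality. Suitability only compares fundamental
  elements of consecutive dimensions, one inside the other, while a member K of the family and the
  sum A may differ by many dimensions and need not be joined by a chain of elements growing by one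
  dimension at a time. Such a chain can be continued until the set reached is orthogonal to the
  simple roots that remain in A; from there on the half-sum splits and no ratio enters any more. The
  ratio \<open>p / q\<close> arises because a bound on \<open>(x, \<pi>\<^sub>K)\<close>, divided by
  the least coefficient q, bounds the plain sum of the coordinates over K, which is then weighted
  again with coefficients at most p. The factor 2 leaves room for two such contributions. The
  inequality is formulated for arbitrary positive numbers in place of the coordinates
  \<open>(x, \<alpha>\<^sub>i)\<close>: that a vertex lies in the chamber is itself deduced from it,
  by altering one coordinate of a point not yet known to be there. The geometry sees half-sums and
  list only through this inequality and through positivity, so it is developed for abstract vectors
  attached to sets of simple roots.\<close>

definition antichain :: "'b set set \<Rightarrow> bool" where
  "antichain T \<longleftrightarrow> (\<forall>U\<in>T. \<forall>U'\<in>T. U \<subseteq> U' \<longrightarrow> U = U')"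

definition maximal_members :: "'b set set \<Rightarrow> 'b set set" where
  "maximal_members F = {A \<in> F. \<forall>C\<in>F. A \<subseteq> C \<longrightarrow> A = C}"

lemma antichain_Union_notin:
  assumes "antichain T" "2 \<le> card T"
  shows "\<Union> T \<notin> T"
proof
  assume *: "\<Union> T \<in> T"
  have "K = \<Union> T" if "K \<in> T" for K
    using assms(1) * that unfolding antichain_def by (meson Union_upper)
  then have "T = {\<Union> T}" using * by blast
  then have "card T = 1" by (metis card_1_singleton_iff One_nat_def)
  then show False using assms(2) by simp
qed

lemma antichain_maximal_members: "antichain (maximal_members F)"
  by (auto simp: antichain_def maximal_members_def)

lemma Union_maximal_members:
  assumes "finite F"
  shows "\<Union> (maximal_members F) = \<Union> F"
proof
  show "\<Union> F \<subseteq> \<Union> (maximal_members F)"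
  proof
    fix i assume "i \<in> \<Union> F"
    then obtain A where A: "A \<in> F" "i \<in> A" by blast
    then obtain C where "C \<in> F" "A \<subseteq> C" "\<forall>D\<in>F. C \<subseteq> D \<longrightarrow> C = D"
      using finite_has_maximal2[OF assms] by metis
    with A show "i \<in> \<Union> (maximal_members F)"
      by (auto simp: maximal_members_def)
  qed
qed (auto simp: maximal_members_def)

text \<open>The points that A adds to the smaller members of S. In a nested family every member
  containing a core point of A contains A, so core points act as pivots that make the associated
  linear systems triangular.\<close>

definition core :: "'b set set \<Rightarrow> 'b set \<Rightarrow> 'b set" where
  "core S A = A - \<Union> {K \<in> S. K \<subset> A}"

text \<open>Building sets in the combinatorial sense. The sets of simple roots that span an element
  of G satisfy these axioms; the direct sum condition survives as closure of overlapping members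
  under union.\<close>

locale finite_building_set =
  fixes I :: "'b set" and B :: "'b set set"
  assumes finite_ground: "finite I"
    and top_mem: "I \<in> B"
    and mem_subset: "J \<in> B \<Longrightarrow> J \<subseteq> I"
    and empty_notin: "{} \<notin> B"
    and singleton_mem: "i \<in> I \<Longrightarrow> {i} \<in> B"
    and Un_mem: "J \<in> B \<Longrightarrow> K \<in> B \<Longrightarrow> J \<inter> K \<noteq> {} \<Longrightarrow> J \<union> K \<in> B"
begin

definition nest :: "'b set set \<Rightarrow> bool" where
  "nest S \<longleftrightarrow> S \<subseteq> B \<and> (\<forall>T\<subseteq>S. 2 \<le> card T \<and> antichain T \<longrightarrow> \<Union> T \<notin> B)"

definition max_nest :: "'b set set \<Rightarrow> bool" where
  "max_nest S \<longleftrightarrow> nest S \<and> (\<forall>T. nest T \<longrightarrow> S \<subseteq> T \<longrightarrow> T = S)"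

lemma finite_building: "finite B"
  using finite_ground mem_subset by (meson Pow_iff finite_Pow_iff finite_subset subsetI)

lemma finite_mem: "J \<in> B \<Longrightarrow> finite J"
  using finite_ground mem_subset finite_subset by blast

lemma finite_nest: "nest S \<Longrightarrow> finite S"
  using finite_building finite_subset by (auto simp: nest_def)

section \<open>Laminarity and cores of nested families\<close>

lemma nest_laminar:
  assumes "nest S" "A \<in> S" "C \<in> S" "A \<inter> C \<noteq> {}"
  shows "A \<subseteq> C \<or> C \<subseteq> A"
proof (rule ccontr)
  assume *: "\<not> ?thesis"
  then have "A \<noteq> C" by blast
  then have "card {A, C} = 2" by simp
  moreover have "antichain {A, C}" using * by (auto simp: antichain_def)
  ultimately have "\<Union> {A, C} \<notin> B"
    using assms unfolding nest_def by (metis empty_subsetI insert_subset order_refl)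
  then show False using Un_mem[of A C] assms by (auto simp: nest_def)
qed

text \<open>If smaller members covered A, the maximal ones among them would form an antichain with
  union A. Two or more contradict nestedness, a single one would equal A, and none would leave A
  empty.\<close>

lemma core_nonempty:
  assumes "nest S" "A \<in> S"
  shows "core S A \<noteq> {}"
proof
  assume "core S A = {}"
  define F where "F = {K \<in> S. K \<subset> A}"
  have fin: "finite F" using finite_nest[OF assms(1)] by (simp add: F_def)
  have U: "\<Union> (maximal_members F) = A"
    using \<open>core S A = {}\<close> Union_maximal_members[OF fin] by (auto simp: core_def F_def)
  have sub: "maximal_members F \<subseteq> F" by (auto simp: maximal_members_def)
  have finm: "finite (maximal_members F)" using sub fin finite_subset by blast
  have "A \<in> B" "A \<noteq> {}" using assms empty_notin by (auto simp: nest_def)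
  show False
  proof (cases "2 \<le> card (maximal_members F)")
    case True
    then have "\<Union> (maximal_members F) \<notin> B"
      using assms(1) sub antichain_maximal_members
      unfolding nest_def F_def by blast
    then show False using U \<open>A \<in> B\<close> by simp
  next
    case False
    then have "card (maximal_members F) = 0 \<or> card (maximal_members F) = 1" by linarith
    then show False
    proof
      assume "card (maximal_members F) = 0"
      then show False using finm U \<open>A \<noteq> {}\<close> by simp
    next
      assume "card (maximal_members F) = 1"
      then obtain K where "maximal_members F = {K}" by (auto simp: card_1_singleton_iff)
      then show False using U sub by (auto simp: F_def)
    qed
  qed
qed

lemma core_minimal:
  assumes "nest S" "A \<in> S" "i \<in> core S A" "C \<in> S" "i \<in> C"
  shows "A \<subseteq> C"
  using nest_laminar[of S A C] assms by (auto simp: core_def)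

lemma core_exists:
  assumes "nest S" "I \<in> S" "i \<in> I"
  obtains A where "A \<in> S" "i \<in> core S A"
proof -
  have fin: "finite {A \<in> S. i \<in> A}" using finite_nest[OF assms(1)] by simp
  have "I \<in> {A \<in> S. i \<in> A}" using assms by simp
  then obtain A where A: "A \<in> S" "i \<in> A" "\<And>C. C \<in> S \<Longrightarrow> i \<in> C \<Longrightarrow> C \<subseteq> A \<Longrightarrow> C = A"
    using finite_has_minimal2[OF fin] by (metis (mono_tags, lifting) mem_Collect_eq)
  then have "i \<in> core S A" by (auto simp: core_def)
  with A that show thesis by blast
qed

section \<open>Maximal nested families\<close>

lemma nest_insert_top:
  assumes "nest S"
  shows "nest (insert I S)"
  unfolding nest_def
proof (intro conjI allI impI)
  show "insert I S \<subseteq> B" using assms top_mem by (auto simp: nest_def)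
  fix T assume T: "T \<subseteq> insert I S" "2 \<le> card T \<and> antichain T"
  have "I \<notin> T"
  proof
    assume "I \<in> T"
    moreover have "\<Union> T \<subseteq> I" using T(1) \<open>insert I S \<subseteq> B\<close> mem_subset by (intro Union_least) auto
    ultimately have "\<Union> T = I" by (intro equalityI Union_upper)
    then show False using antichain_Union_notin[of T] T(2) \<open>I \<in> T\<close> by simp
  qed
  then have "T \<subseteq> S" using T by blast
  then show "\<Union> T \<notin> B" using T assms unfolding nest_def by blast
qed

lemma max_nest_top: "max_nest S \<Longrightarrow> I \<in> S"
  using nest_insert_top unfolding max_nest_def by blast

lemma max_nest_extend:
  assumes "nest S"
  obtains M where "max_nest M" "S \<subseteq> M"
proof -
  have "finite {M. nest M}"
    using finite_building by (rule finite_subset[rotated, OF finite_Pow_iff[THEN iffD2]])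
      (auto simp: nest_def)
  from finite_has_maximal2[OF this, of S] assms
  obtain M where "nest M" "S \<subseteq> M" "\<forall>N. nest N \<longrightarrow> M \<subseteq> N \<longrightarrow> M = N" by auto
  then show thesis using that[of M] unfolding max_nest_def by metis
qed

text \<open>
  If the core of \<open>A\<close> contains two points \<open>i\<close> and \<open>j\<close>, the largest member \<open>M\<close> of \<open>B\<close> with
  \<open>j \<in> M \<subseteq> A - {i}\<close> can be added to the family.
\<close>

lemma max_nest_core_singleton:
  assumes S: "max_nest S" and A: "A \<in> S" and i: "i \<in> core S A" and j: "j \<in> core S A"
  shows "i = j"
proof (rule ccontr)
  assume "i \<noteq> j"
  have nS: "nest S" using S by (simp add: max_nest_def)
  have AB: "A \<in> B" using nS A by (auto simp: nest_def)
  have iA: "i \<in> A" and jA: "j \<in> A" using i j by (auto simp: core_def)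
  define F where "F = {M \<in> B. j \<in> M \<and> M \<subseteq> A - {i}}"
  have "finite F" using finite_building by (simp add: F_def)
  moreover have "{j} \<in> F"
    using singleton_mem[of j] mem_subset[OF AB] jA \<open>i \<noteq> j\<close> by (auto simp: F_def)
  ultimately obtain M where M: "M \<in> F" "\<And>N. N \<in> F \<Longrightarrow> M \<subseteq> N \<Longrightarrow> M = N"
    using finite_has_maximal[of F] by blast
  have MB: "M \<in> B" "j \<in> M" "M \<subseteq> A" "i \<notin> M" using M by (auto simp: F_def)
  have Mmax: "N \<subseteq> M" if "N \<in> F" for N
  proof -
    have "M \<union> N \<in> F" using M(1) that Un_mem[of M N] by (auto simp: F_def)
    then show ?thesis using M(2)[of "M \<union> N"] by blast
  qed
  have "M \<notin> S" using core_minimal[OF nS A j, of M] MB iA by blast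
  have "nest (insert M S)"
    unfolding nest_def
  proof (intro conjI allI impI notI)
    show "insert M S \<subseteq> B" using nS MB by (auto simp: nest_def)
    fix T assume T: "T \<subseteq> insert M S" "2 \<le> card T \<and> antichain T" and UB: "\<Union> T \<in> B"
    have MT: "M \<in> T" using T UB nS by (auto simp: nest_def)
    have inc: "\<not> C \<subseteq> M" "\<not> M \<subseteq> C" if "C \<in> T" "C \<noteq> M" for C
      using T MT that by (auto simp: antichain_def)
    have CA: "C \<subset> A \<or> C \<inter> A = {}" if "C \<in> T" "C \<noteq> M" for C
    proof -
      have "C \<in> S" using that T by blast
      moreover have "\<not> A \<subseteq> C" using inc(2)[OF that] MB by blast
      ultimately show ?thesis using nest_laminar[OF nS, of C A] A by blast
    qed
    have T2: "T - {M} \<noteq> {}"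
    proof
      assume "T - {M} = {}"
      then have "T = {M}" using MT by blast
      then show False using T by simp
    qed
    show False
    \<comment> \<open>If all of T stays inside A, its union avoids the core point i and is a
      competitor of M that is not contained in M.\<close>
    proof (cases "\<forall>C\<in>T - {M}. C \<subset> A")
      case True
      have "i \<notin> C" if "C \<in> T - {M}" for C
        using that True T core_minimal[OF nS A i, of C] by blast
      then have "\<Union> T \<in> F" using UB MB MT True by (auto simp: F_def)
      then show False using Mmax[of "\<Union> T"] T2 inc(1) by blast
    next
      case False
      \<comment> \<open>Some member of T misses A. Replacing everything in T that lies inside A by A
        itself gives an antichain of the old family; its union \<open>A \<union> \<Union> T\<close>
        is in B because both parts contain M.\<close>
      define R where "R = insert A {C \<in> T - {M}. C \<inter> A = {}}"
      have RS: "R \<subseteq> S" using A T by (auto simp: R_def)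
      obtain C where C: "C \<in> T" "C \<noteq> M" "C \<inter> A = {}" using False CA by blast
      have "C \<noteq> A" using C iA by blast
      have "{A, C} \<subseteq> R" using C by (auto simp: R_def)
      moreover have "finite R" using RS finite_nest[OF nS] finite_subset by blast
      ultimately have "card {A, C} \<le> card R" by (meson card_mono)
      then have "2 \<le> card R" using \<open>C \<noteq> A\<close> by simp
      moreover have "antichain R"
      proof -
        have ne: "C \<noteq> {}" if "C \<in> T - {M}" for C
          using inc that by blast
        have "A \<noteq> {}" using iA by blast
        then show ?thesis
          unfolding antichain_def R_def using T ne
          by (auto simp: antichain_def) blast+
      qed
      ultimately have "\<Union> R \<notin> B" using nS RS by (auto simp: nest_def)
      moreover have "\<Union> R = A \<union> \<Union> T"
      proof
        show "\<Union> R \<subseteq> A \<union> \<Union> T" by (auto simp: R_def)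
        show "A \<union> \<Union> T \<subseteq> \<Union> R"
        proof
          fix x assume "x \<in> A \<union> \<Union> T"
          then consider "x \<in> A" | C where "x \<in> C" "C \<in> T" "x \<notin> A" by blast
          then show "x \<in> \<Union> R"
          proof cases
            case (2 C)
            then have "C \<noteq> M" using MB by blast
            then have "C \<inter> A = {}" using CA 2 by blast
            then show ?thesis using 2 \<open>C \<noteq> M\<close> unfolding R_def by blast
          qed (simp add: R_def)
        qed
      qed
      moreover have "A \<union> \<Union> T \<in> B" using Un_mem[OF AB UB] MB MT by blast
      ultimately show False by simp
    qed
  qed
  moreover have "insert M S = S" if "nest (insert M S)"
    using S that unfolding max_nest_def by (meson subset_insertI)
  ultimately show False using \<open>M \<notin> S\<close> by blast
qed

lemma max_nest_core:
  assumes "max_nest S" "A \<in> S"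
  obtains i where "core S A = {i}"
proof -
  have "core S A \<noteq> {}" using core_nonempty assms unfolding max_nest_def by blast
  then obtain i where "i \<in> core S A" by blast
  then have "core S A = {i}" using max_nest_core_singleton[OF assms] by blast
  then show thesis by (rule that)
qed

text \<open>Sending a member to the single point of its core is a bijection onto the ground set: the
  smallest member containing a point is its preimage.\<close>

lemma card_max_nest:
  assumes "max_nest S"
  shows "card S = card I"
proof -
  have nS: "nest S" using assms unfolding max_nest_def by blast
  have "\<exists>i. core S A = {i}" if "A \<in> S" for A
    by (rule max_nest_core[OF assms that]) blast
  then have "\<exists>g. \<forall>A\<in>S. core S A = {g A}" by (intro bchoice ballI)
  then obtain g where g: "\<And>A. A \<in> S \<Longrightarrow> core S A = {g A}" by blast
  have gc: "g A \<in> core S A" "g A \<in> A" if "A \<in> S" for A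
  proof -
    show "g A \<in> core S A" using g[OF that] by simp
    then show "g A \<in> A" by (simp add: core_def)
  qed
  have "inj_on g S"
  proof (rule inj_onI)
    fix A C assume A: "A \<in> S" "C \<in> S" "g A = g C"
    have "A \<subseteq> C" using core_minimal[OF nS A(1) gc(1)[OF A(1)] A(2)] gc(2)[OF A(2)] A(3) by simp
    moreover have "C \<subseteq> A" using core_minimal[OF nS A(2) gc(1)[OF A(2)] A(1)] gc(2)[OF A(1)] A(3) by simp
    ultimately show "A = C" by blast
  qed
  moreover have "g ` S = I"
  proof
    show "g ` S \<subseteq> I"
    proof
      fix i assume "i \<in> g ` S"
      then obtain A where A: "A \<in> S" "i = g A" by blast
      then have "A \<in> B" using nS unfolding nest_def by (meson subsetD)
      then show "i \<in> I" using A gc(2)[OF A(1)] mem_subset[of A] by (simp add: subsetD)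
    qed
    show "I \<subseteq> g ` S"
    proof
      fix i assume "i \<in> I"
      then obtain A where "A \<in> S" "i \<in> core S A"
        by (rule core_exists[OF nS max_nest_top[OF assms]])
      then show "i \<in> g ` S" using g[of A] by simp
    qed
  qed
  ultimately show ?thesis using card_image[of g S] by simp
qed

end

subsection \<open>The polytope of a finite building set\<close>

lemma exists_inner_eq:
  fixes b :: "'a::euclidean_space set"
  assumes "independent b"
  obtains x where "\<And>v. v \<in> b \<Longrightarrow> x \<bullet> v = f v"
proof -
  obtain g :: "'a \<Rightarrow> real" where g: "linear g" "\<And>v. v \<in> b \<Longrightarrow> g v = f v"
    using linear_independent_extend[OF assms, of f] by blast
  \<comment> \<open>The Riesz vector of the functional g extending f.\<close>
  define x where "x = (\<Sum>i\<in>Basis. g i *\<^sub>R i)"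
  have "x \<bullet> v = g v" for v
  proof -
    have "g v = g (\<Sum>i\<in>Basis. (v \<bullet> i) *\<^sub>R i)" by (simp add: euclidean_representation)
    also have "\<dots> = (\<Sum>i\<in>Basis. (v \<bullet> i) * g i)"
      by (simp add: linear_sum[OF g(1)] linear_scale[OF g(1)])
    finally show ?thesis by (simp add: x_def inner_sum_left inner_commute[of v] mult.commute)
  qed
  then show thesis using g(2) that[of x] by simp
qed

lemma dim_orthogonal_complement_of:
  fixes b :: "'a::euclidean_space set"
  assumes "independent b"
  shows "dim {x. \<forall>v\<in>b. x \<bullet> v = 0} = DIM('a) - card b" "card b \<le> DIM('a)"
proof -
  have "{x. \<forall>v\<in>b. x \<bullet> v = 0} = {y \<in> UNIV. \<forall>x\<in>span b. orthogonal x y}"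
  proof -
    have "(\<forall>v\<in>b. x \<bullet> v = 0) \<longleftrightarrow> (\<forall>v\<in>span b. orthogonal v x)" for x
    proof
      assume "\<forall>v\<in>b. x \<bullet> v = 0"
      then have "\<And>v. v \<in> b \<Longrightarrow> orthogonal x v" by (simp add: orthogonal_def)
      then show "\<forall>v\<in>span b. orthogonal v x"
        using orthogonal_to_span orthogonal_commute by blast
    next
      assume "\<forall>v\<in>span b. orthogonal v x"
      then show "\<forall>v\<in>b. x \<bullet> v = 0"
        by (simp add: orthogonal_def inner_commute span_base)
    qed
    then show ?thesis by simp
  qed
  moreover have "dim {y \<in> UNIV. \<forall>x\<in>span b. orthogonal x y} + dim (span b) = dim (UNIV :: 'a set)"
    by (rule dim_subspace_orthogonal_to_vectors) (auto intro: subspace_span)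
  moreover have "dim (span b) = card b"
    using assms by (simp add: dim_eq_card_independent dim_span)
  ultimately show "dim {x. \<forall>v\<in>b. x \<bullet> v = 0} = DIM('a) - card b" "card b \<le> DIM('a)"
    by auto
qed

text \<open>
  \<open>union_less\<close> says that the hyperplanes of a family whose union is a further member of the
  building set do not meet within the polytope.
\<close>

locale nested_polytope = finite_building_set I B
  for I :: "'a::euclidean_space set" and B :: "'a set set" +
  fixes p :: "'a set \<Rightarrow> 'a" and c :: "'a set \<Rightarrow> 'a \<Rightarrow> real" and e :: "'a set \<Rightarrow> real"
  assumes indep: "independent I" and span_ground: "span I = UNIV"
    and inner_p: "J \<in> B \<Longrightarrow> x \<bullet> p J = (\<Sum>i\<in>J. c J i * (x \<bullet> i))"
    and c_pos: "J \<in> B \<Longrightarrow> i \<in> J \<Longrightarrow> 0 < c J i"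
    and e_pos: "J \<in> B \<Longrightarrow> 0 < e J"
    and union_less: "\<And>A f. A \<subseteq> B \<Longrightarrow> \<Union> A \<in> B \<Longrightarrow> \<Union> A \<notin> A \<Longrightarrow> \<forall>i\<in>\<Union> A. 0 < f i \<Longrightarrow>
      \<forall>K\<in>A. (\<Sum>i\<in>K. c K i * f i) \<le> e K \<Longrightarrow> (\<Sum>i\<in>\<Union> A. c (\<Union> A) i * f i) < e (\<Union> A)"
begin

section \<open>Tight constraints and independence of the vectors of a nested family\<close>

definition P :: "'a set" where
  "P = {x. x \<bullet> p I = e I \<and> (\<forall>J\<in>B. e J \<le> x \<bullet> p J)}"

definition tight :: "'a \<Rightarrow> 'a set set" where
  "tight x = {J \<in> B. x \<bullet> p J = e J}"

lemma P_pos: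
  assumes "x \<in> P" "i \<in> I"
  shows "0 < x \<bullet> i"
proof -
  have "{i} \<in> B" using assms singleton_mem by blast
  then have "0 < c {i} i * (x \<bullet> i)"
    using assms inner_p[of "{i}" x] e_pos[of "{i}"] by (auto simp: P_def)
  then show ?thesis using c_pos[OF \<open>{i} \<in> B\<close>, of i] by (simp add: zero_less_mult_iff)
qed

lemma nest_tight:
  assumes "x \<in> P"
  shows "nest (tight x)" "I \<in> tight x"
proof -
  show "I \<in> tight x" using assms top_mem by (simp add: P_def tight_def)
  show "nest (tight x)"
    unfolding nest_def
  proof (intro conjI allI impI notI)
    show "tight x \<subseteq> B" by (auto simp: tight_def)
    fix T assume T: "T \<subseteq> tight x" "2 \<le> card T \<and> antichain T" and U: "\<Union> T \<in> B"
    have "\<Union> T \<notin> T" using antichain_Union_notin T(2) by blast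
    moreover have TB: "T \<subseteq> B" using T by (auto simp: tight_def)
    moreover have "\<forall>K\<in>T. (\<Sum>i\<in>K. c K i * (x \<bullet> i)) \<le> e K"
      using T TB by (auto simp: tight_def simp flip: inner_p)
    moreover have "\<forall>i\<in>\<Union> T. 0 < x \<bullet> i"
      using P_pos[OF assms] mem_subset[OF U] by blast
    ultimately have "x \<bullet> p (\<Union> T) < e (\<Union> T)"
      using union_less[of T "\<lambda>i. x \<bullet> i"] U inner_p[OF U] by simp
    then show False using assms U by (auto simp: P_def)
  qed
qed

text \<open>Take M maximal among the members with nonzero scalar and pair the relation with the dual
  vector of a core point of M. Only members containing that point survive, they all contain M, and
  by maximality only M itself is left.\<close>

lemma nest_scalars_zero:
  assumes S: "nest S" and r: "(\<Sum>A\<in>S. r A *\<^sub>R p A) = 0" and "A \<in> S"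
  shows "r A = 0"
proof (rule ccontr)
  assume "r A \<noteq> 0"
  have fin: "finite S" using S by (rule finite_nest)
  have SB: "S \<subseteq> B" using S by (simp add: nest_def)
  have "finite {A \<in> S. r A \<noteq> 0}" using fin by simp
  then obtain M where M: "M \<in> S" "r M \<noteq> 0" "\<And>C. C \<in> S \<Longrightarrow> r C \<noteq> 0 \<Longrightarrow> M \<subseteq> C \<Longrightarrow> M = C"
    using finite_has_maximal[of "{A \<in> S. r A \<noteq> 0}"] \<open>A \<in> S\<close> \<open>r A \<noteq> 0\<close> by blast
  obtain i where i: "i \<in> core S M" using core_nonempty[OF S M(1)] by blast
  have iM: "i \<in> M" using i by (simp add: core_def)
  obtain x where x: "\<And>j. j \<in> I \<Longrightarrow> x \<bullet> j = (if j = i then 1 else 0)"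
    using exists_inner_eq[OF indep, of "\<lambda>j. if j = i then 1 else 0"] by blast
  have xp: "x \<bullet> p C = (if i \<in> C then c C i else 0)" if "C \<in> S" for C
  proof -
    have C: "C \<in> B" using that SB by blast
    have "(\<Sum>j\<in>C. c C j * (x \<bullet> j)) = (\<Sum>j\<in>C. if j = i then c C i else 0)"
      using mem_subset[OF C] x by (intro sum.cong) auto
    then show ?thesis using inner_p[OF C] finite_mem[OF C] by simp
  qed
  have "0 = x \<bullet> (\<Sum>A\<in>S. r A *\<^sub>R p A)" using r by simp
  also have "\<dots> = (\<Sum>C\<in>S. r C * (x \<bullet> p C))" by (simp add: inner_sum_right)
  also have "\<dots> = (\<Sum>C\<in>{M}. r C * (x \<bullet> p C))"
  proof (rule sum.mono_neutral_right[OF fin])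
    show "{M} \<subseteq> S" using M by simp
    show "\<forall>C\<in>S - {M}. r C * (x \<bullet> p C) = 0"
    proof
      fix C assume C: "C \<in> S - {M}"
      show "r C * (x \<bullet> p C) = 0"
      proof (cases "i \<in> C")
        case True
        then have "M \<subseteq> C" using core_minimal[OF S M(1) i] C by blast
        then have "r C = 0" using M(3)[of C] C by blast
        then show ?thesis by simp
      qed (use xp C in simp)
    qed
  qed
  also have "\<dots> = r M * c M i" using xp M(1) iM by simp
  finally show False using M(2) c_pos[of M i] iM M(1) SB by auto
qed

text \<open>The scalars above are indexed by members and not by vectors, so a coincidence
  \<open>p A = p C\<close> is already a forbidden relation.\<close>

lemma nest_inj: assumes "nest S" shows "inj_on p S"
proof (rule inj_onI)
  fix A C assume A: "A \<in> S" "C \<in> S" "p A = p C"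
  show "A = C"
  proof (rule ccontr)
    assume "A \<noteq> C"
    define r where "r D = (if D = A then 1 else if D = C then -1 else (0::real))" for D
    have "(\<Sum>D\<in>S. r D *\<^sub>R p D) = (\<Sum>D\<in>{A, C}. r D *\<^sub>R p D)"
      by (rule sum.mono_neutral_right[OF finite_nest[OF assms]]) (use A in \<open>auto simp: r_def\<close>)
    also have "\<dots> = 0" using \<open>A \<noteq> C\<close> A by (simp add: r_def)
    finally have "r A = 0" using nest_scalars_zero[OF assms _ A(1)] by blast
    then show False by (simp add: r_def)
  qed
qed

lemma nest_independent: assumes "nest S" shows "independent (p ` S)"
proof (rule independent_if_scalars_zero)
  show "finite (p ` S)" using finite_nest[OF assms] by simp
  fix f v assume "(\<Sum>x\<in>p ` S. f x *\<^sub>R x) = 0" "v \<in> p ` S"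
  then obtain A where A: "A \<in> S" "v = p A" "(\<Sum>A\<in>S. f (p A) *\<^sub>R p A) = 0"
    using nest_inj[OF assms] by (auto simp: sum.reindex)
  then show "f v = 0" using nest_scalars_zero[OF assms A(3) A(1)] by simp
qed

lemma nest_solve:
  assumes "nest S"
  obtains x where "\<And>A. A \<in> S \<Longrightarrow> x \<bullet> p A = g A"
proof -
  obtain x where x: "\<And>v. v \<in> p ` S \<Longrightarrow> x \<bullet> v = g (the_inv_into S p v)"
    using exists_inner_eq[OF nest_independent[OF assms], of "\<lambda>v. g (the_inv_into S p v)"] by blast
  have "x \<bullet> p A = g A" if "A \<in> S" for A
    using x[of "p A"] that nest_inj[OF assms] by (simp add: the_inv_into_f_f)
  then show thesis by (rule that)
qed

text \<open>
  If the core of \<open>A\<close> is \<open>{i}\<close>, replace the coordinate at \<open>i\<close> by the positive value for which \<open>{i}\<close>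
  is tight. The family members below \<open>A\<close> stay tight, so by \<open>union_less\<close> the sum for \<open>A\<close> drops
  below \<open>e A\<close>, which means that the original coordinate was larger.
\<close>

lemma max_nest_solution_pos:
  assumes S: "max_nest S" and x: "\<And>A. A \<in> S \<Longrightarrow> x \<bullet> p A = e A"
  shows "A \<in> S \<Longrightarrow> i \<in> A \<Longrightarrow> 0 < x \<bullet> i"
proof (induction "card A" arbitrary: A i rule: less_induct)
  case less
  have nS: "nest S" using S by (simp add: max_nest_def)
  have SB: "S \<subseteq> B" using nS by (simp add: nest_def)
  have AB: "A \<in> B" using less SB by blast
  obtain k where k: "core S A = {k}" by (rule max_nest_core[OF S less.prems(1)])
  have kA: "k \<in> A" using k by (auto simp: core_def)
  have kI: "k \<in> I" using kA mem_subset[OF AB] by blast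
  have kB: "{k} \<in> B" using singleton_mem[OF kI] .
  have below: "0 < x \<bullet> j" if "K \<in> S" "K \<subset> A" "j \<in> K" for K j
    using less.hyps[of K j] that psubset_card_mono[OF finite_mem[OF AB]] by blast
  have rest: "0 < x \<bullet> j" if "j \<in> A" "j \<noteq> k" for j
  proof -
    have "j \<notin> core S A" using that k by simp
    then show ?thesis using that below by (auto simp: core_def)
  qed
  have "0 < x \<bullet> k"
  \<comment> \<open>For \<open>A = {k}\<close> the family T used in the other case would contain its
    own union, and \<open>union_less\<close> would not apply; here tightness gives the sign
    directly.\<close>
  proof (cases "A = {k}")
    case True
    then have "c {k} k * (x \<bullet> k) = e {k}" using inner_p[OF kB, of x] x less.prems(1) by simp
    then have "0 < c {k} k * (x \<bullet> k)" using e_pos[OF kB] by simp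
    then show ?thesis using c_pos[OF kB, of k] by (simp add: zero_less_mult_iff)
  next
    case False
    define t where "t = e {k} / c {k} k"
    have t: "0 < t" "c {k} k * t = e {k}"
      using e_pos[OF kB] c_pos[OF kB, of k] by (simp_all add: t_def)
    define f where "f j = (if j = k then t else x \<bullet> j)" for j
    define T where "T = insert {k} {K \<in> S. K \<subset> A}"
    have UT: "\<Union> T = A"
    proof
      show "\<Union> T \<subseteq> A" using kA by (auto simp: T_def)
      have "A \<subseteq> core S A \<union> \<Union> {K \<in> S. K \<subset> A}" by (auto simp: core_def)
      then show "A \<subseteq> \<Union> T" using k by (auto simp: T_def)
    qed
    have "\<forall>K\<in>T. (\<Sum>j\<in>K. c K j * f j) \<le> e K"
    proof
      fix K assume "K \<in> T"
      then consider "K = {k}" | "K \<in> S" "K \<subset> A" by (auto simp: T_def)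
      then show "(\<Sum>j\<in>K. c K j * f j) \<le> e K"
      proof cases
        case 1 then show ?thesis using t by (simp add: f_def)
      next
        case 2
        then have "k \<notin> K" using k by (auto simp: core_def)
        then have "(\<Sum>j\<in>K. c K j * f j) = (\<Sum>j\<in>K. c K j * (x \<bullet> j))"
          by (intro sum.cong) (auto simp: f_def)
        also have "\<dots> = e K" using inner_p[of K x] x[of K] 2 SB by auto
        finally show ?thesis by simp
      qed
    qed
    moreover have "\<forall>j\<in>\<Union> T. 0 < f j" using rest t by (simp add: UT f_def)
    moreover have "A \<notin> T" using False by (auto simp: T_def)
    moreover have "T \<subseteq> B" using kB SB by (auto simp: T_def)
    ultimately have "(\<Sum>j\<in>A. c A j * f j) < e A"
      using union_less[of T f] AB by (simp add: UT)
    also have "e A = (\<Sum>j\<in>A. c A j * (x \<bullet> j))" using inner_p[OF AB, of x] x[OF less.prems(1)] by simp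
    finally have "c A k * f k + (\<Sum>j\<in>A - {k}. c A j * f j) <
        c A k * (x \<bullet> k) + (\<Sum>j\<in>A - {k}. c A j * (x \<bullet> j))"
      using sum.remove[OF finite_mem[OF AB] kA, of "\<lambda>j. c A j * f j"]
        sum.remove[OF finite_mem[OF AB] kA, of "\<lambda>j. c A j * (x \<bullet> j)"] by simp
    moreover have "(\<Sum>j\<in>A - {k}. c A j * f j) = (\<Sum>j\<in>A - {k}. c A j * (x \<bullet> j))"
      by (intro sum.cong) (auto simp: f_def)
    ultimately have "c A k * t < c A k * (x \<bullet> k)" by (simp add: f_def)
    then have "t < x \<bullet> k" using c_pos[OF AB kA] by simp
    then show ?thesis using t by simp
  qed
  then show ?case using rest less.prems by blast
qed

section \<open>Vertices, and points with a prescribed tight set\<close>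

lemma max_nest_vertex:
  assumes S: "max_nest S" and x: "\<And>A. A \<in> S \<Longrightarrow> x \<bullet> p A = e A"
  shows "x \<in> P" "tight x = S"
proof -
  have nS: "nest S" using S by (simp add: max_nest_def)
  have SB: "S \<subseteq> B" using nS by (simp add: nest_def)
  have IS: "I \<in> S" using max_nest_top[OF S] .
  have pos: "0 < x \<bullet> i" if "i \<in> I" for i
    using max_nest_solution_pos[OF S x IS that] by simp
  have strict: "e J < x \<bullet> p J" if J: "J \<in> B" "J \<notin> S" for J
  proof (rule ccontr)
    assume not_less: "\<not> ?thesis"
    \<comment> \<open>Equality counts as a violation: emptiness of F then yields strict inequalities
      outside S, hence the exact tight set.\<close>
    define F where "F = {J \<in> B. J \<notin> S \<and> x \<bullet> p J \<le> e J}"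
    have "finite F" "F \<noteq> {}" using finite_building not_less J by (auto simp: F_def)
    then obtain M where M: "M \<in> F" "\<And>K. K \<in> F \<Longrightarrow> M \<subseteq> K \<Longrightarrow> M = K"
      using finite_has_maximal[of F] by blast
    have MB: "M \<in> B" "M \<notin> S" "x \<bullet> p M \<le> e M" using M by (auto simp: F_def)
    \<comment> \<open>Maximality of S provides an antichain through M with union in B. Its members
      from S are tight and M is violated, so \<open>union_less\<close> makes the union a violated
      constraint strictly containing M.\<close>
    have "\<not> nest (insert M S)"
      using S MB(2) unfolding max_nest_def by (metis insertI1 subset_insertI)
    moreover have sub: "insert M S \<subseteq> B" using MB SB by simp
    ultimately obtain T where T: "T \<subseteq> insert M S" "2 \<le> card T" "antichain T" "\<Union> T \<in> B"
      unfolding nest_def by blast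
    have MT: "M \<in> T"
    proof (rule ccontr)
      assume "M \<notin> T"
      then have "T \<subseteq> S" using T(1) by blast
      then show False using nS T unfolding nest_def by blast
    qed
    have "\<Union> T \<notin> T" using antichain_Union_notin[OF T(3,2)] .
    have "(\<Sum>i\<in>\<Union> T. c (\<Union> T) i * (x \<bullet> i)) < e (\<Union> T)"
    proof (rule union_less[OF _ T(4) \<open>\<Union> T \<notin> T\<close>])
      show TB: "T \<subseteq> B" using T(1) sub by blast
      show "\<forall>i\<in>\<Union> T. 0 < x \<bullet> i" using pos mem_subset[OF T(4)] by blast
      show "\<forall>K\<in>T. (\<Sum>i\<in>K. c K i * (x \<bullet> i)) \<le> e K"
      proof
        fix K assume K: "K \<in> T"
        then have "x \<bullet> p K \<le> e K" using T(1) x[of K] MB(3) by (cases "K = M") auto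
        then show "(\<Sum>i\<in>K. c K i * (x \<bullet> i)) \<le> e K" using K TB inner_p[of K x] by auto
      qed
    qed
    then have less: "x \<bullet> p (\<Union> T) < e (\<Union> T)" using inner_p[OF T(4)] by simp
    then have "\<Union> T \<notin> S" using x[of "\<Union> T"] by auto
    then have "\<Union> T \<in> F" using less T(4) by (simp add: F_def)
    then have "M = \<Union> T" using M(2)[of "\<Union> T"] MT by blast
    then show False using MT \<open>\<Union> T \<notin> T\<close> by simp
  qed
  show "x \<in> P"
    unfolding P_def using x[OF IS] x strict by (auto intro: less_imp_le) (metis order_refl less_imp_le)
  show "tight x = S"
    unfolding tight_def using x strict SB by fastforce
qed

text \<open>The finitely many slack constraints stay strict for small s by continuity, while a tight
  one changes by exactly \<open>s * (d \<bullet> p J)\<close>. This serves both to leave a vertex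
  and to prolong a segment inside P.\<close>

lemma perturb:
  assumes x: "x \<in> P" and d: "\<And>J. J \<in> tight x \<Longrightarrow> 0 \<le> d \<bullet> p J" "d \<bullet> p I = 0"
  obtains s where "0 < s" "x + s *\<^sub>R d \<in> P" "tight (x + s *\<^sub>R d) = {J \<in> tight x. d \<bullet> p J = 0}"
proof -
  have "eventually (\<lambda>s. e J < (x + s *\<^sub>R d) \<bullet> p J) (at_right 0)" if "J \<in> B - tight x" for J
  proof (rule order_tendstoD)
    show "((\<lambda>s. (x + s *\<^sub>R d) \<bullet> p J) \<longlongrightarrow> (x + 0 *\<^sub>R d) \<bullet> p J) (at_right 0)"
      by (intro tendsto_intros)
    show "e J < (x + 0 *\<^sub>R d) \<bullet> p J"
      using that x by (force simp: P_def tight_def)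
  qed
  then have "eventually (\<lambda>s. \<forall>J\<in>B - tight x. e J < (x + s *\<^sub>R d) \<bullet> p J) (at_right 0)"
    using finite_building by (intro eventually_ball_finite) auto
  then have "eventually (\<lambda>s. 0 < s \<and> (\<forall>J\<in>B - tight x. e J < (x + s *\<^sub>R d) \<bullet> p J)) (at_right (0::real))"
    using eventually_at_right_less[of 0] by eventually_elim auto
  then obtain s where s: "0 < s" "\<And>J. J \<in> B \<Longrightarrow> J \<notin> tight x \<Longrightarrow> e J < (x + s *\<^sub>R d) \<bullet> p J"
    using eventually_happens'[of "at_right (0::real)"] by force
  have t: "(x + s *\<^sub>R d) \<bullet> p J = e J + s * (d \<bullet> p J)" if "J \<in> tight x" for J
    using that by (simp add: tight_def inner_add_left)
  have "e J \<le> (x + s *\<^sub>R d) \<bullet> p J" if "J \<in> B" for J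
    using t[of J] s(2)[of J] d(1)[of J] s(1) that by (cases "J \<in> tight x") auto
  moreover have "(x + s *\<^sub>R d) \<bullet> p I = e I"
    using d(2) x by (simp add: P_def inner_add_left)
  ultimately have "x + s *\<^sub>R d \<in> P" by (simp add: P_def)
  moreover have "tight (x + s *\<^sub>R d) = {J \<in> tight x. d \<bullet> p J = 0}"
  proof (rule set_eqI)
    fix J
    show "J \<in> tight (x + s *\<^sub>R d) \<longleftrightarrow> J \<in> {J \<in> tight x. d \<bullet> p J = 0}"
    proof (cases "J \<in> tight x")
      case True
      then have "J \<in> B" by (simp add: tight_def)
      then show ?thesis using True t[OF True] s(1) by (auto simp: tight_def)
    next
      case False
      then show ?thesis using s(2)[of J] by (force simp: tight_def)
    qed
  qed
  ultimately show thesis using that s(1) by blast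
qed

lemma nest_realized:
  assumes "nest S" "I \<in> S"
  obtains x where "x \<in> P" "tight x = S"
proof -
  obtain M where M: "max_nest M" "S \<subseteq> M" using max_nest_extend[OF assms(1)] .
  have nM: "nest M" using M by (simp add: max_nest_def)
  obtain v where v: "\<And>A. A \<in> M \<Longrightarrow> v \<bullet> p A = e A" using nest_solve[OF nM, of e] by blast
  note vP = max_nest_vertex[OF M(1) v]
  obtain d where d: "\<And>A. A \<in> M \<Longrightarrow> d \<bullet> p A = (if A \<in> S then 0 else 1)"
    using nest_solve[OF nM, of "\<lambda>A. if A \<in> S then 0 else 1"] by blast
  obtain s where "v + s *\<^sub>R d \<in> P" "tight (v + s *\<^sub>R d) = {J \<in> tight v. d \<bullet> p J = 0}"
  proof (rule perturb[OF vP(1), of d])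
    show "0 \<le> d \<bullet> p J" if "J \<in> tight v" for J using that vP(2) d[of J] by simp
    show "d \<bullet> p I = 0" using d[of I] M assms by auto
  qed
  moreover have "{J \<in> tight v. d \<bullet> p J = 0} = S"
    using vP(2) d M(2) by (auto split: if_splits)
  ultimately show thesis using that by simp
qed

definition face :: "'a set set \<Rightarrow> 'a set" where
  "face S = {x \<in> P. S \<subseteq> tight x}"

lemma polyhedron_P: "polyhedron P"
proof -
  have "P = {x. p I \<bullet> x = e I} \<inter> \<Inter> ((\<lambda>J. {x. p J \<bullet> x \<ge> e J}) ` B)"
    by (auto simp: P_def inner_commute)
  also have "polyhedron \<dots>"
    using finite_building
    by (intro polyhedron_Int polyhedron_Inter polyhedron_hyperplane)
      (auto intro: polyhedron_halfspace_ge)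
  finally show ?thesis .
qed

lemma convex_P: "convex P"
  using polyhedron_P by (rule polyhedron_imp_convex)

lemma bounded_P: "bounded P"
proof -
  \<comment> \<open>On P all terms of \<open>x \<bullet> p I = e I\<close> are positive, so each
    single term is at most \<open>e I\<close>.\<close>
  define m where "m i = e I / c I i" for i
  have m: "\<bar>x \<bullet> i\<bar> \<le> m i" if "x \<in> P" "i \<in> I" for x i
  proof -
    have "c I i * (x \<bullet> i) \<le> (\<Sum>i\<in>I. c I i * (x \<bullet> i))"
      using that finite_ground P_pos[OF that(1)] c_pos[OF top_mem]
      by (intro member_le_sum) (auto intro!: mult_nonneg_nonneg less_imp_le)
    also have "\<dots> = e I" using that inner_p[OF top_mem, of x] by (simp add: P_def)
    finally show ?thesis
      using P_pos[OF that] c_pos[OF top_mem that(2)] by (simp add: m_def field_simps)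
  qed
  have "\<exists>C. \<forall>x\<in>P. \<bar>x \<bullet> b\<bar> \<le> C" for b
  proof -
    have "b \<in> span I" using span_ground by simp
    then obtain r where r: "b = (\<Sum>i\<in>I. r i *\<^sub>R i)"
      using span_finite[OF finite_ground] by auto
    have "\<bar>x \<bullet> b\<bar> \<le> (\<Sum>i\<in>I. \<bar>r i\<bar> * m i)" if "x \<in> P" for x
    proof -
      have "\<bar>x \<bullet> b\<bar> \<le> (\<Sum>i\<in>I. \<bar>r i * (x \<bullet> i)\<bar>)"
        by (simp add: r inner_sum_right)
      also have "\<dots> \<le> (\<Sum>i\<in>I. \<bar>r i\<bar> * m i)"
        using m[OF that] by (intro sum_mono) (auto simp: abs_mult intro: mult_left_mono)
      finally show ?thesis .
    qed
    then show ?thesis by blast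
  qed
  then obtain C where C: "\<And>b x. x \<in> P \<Longrightarrow> \<bar>x \<bullet> b\<bar> \<le> C b" by metis
  have "norm x \<le> (\<Sum>b\<in>Basis. C b)" if "x \<in> P" for x
    using norm_le_l1[of x] C[OF that] by (meson order_trans sum_mono)
  then show ?thesis by (meson boundedI)
qed

lemma polytope_P: "polytope P"
  using polyhedron_P bounded_P polytope_eq_bounded_polyhedron by blast

lemma face_face_of:
  assumes "S \<subseteq> B"
  shows "face S face_of P"
  unfolding face_of_def
proof (intro conjI ballI impI)
  show "face S \<subseteq> P" by (auto simp: face_def)
  have "face S = P \<inter> {x. \<forall>J\<in>S. p J \<bullet> x = e J}"
    using assms by (auto simp: face_def tight_def inner_commute)
  also have "{x. \<forall>J\<in>S. p J \<bullet> x = e J} = (\<Inter>J\<in>S. {x. p J \<bullet> x = e J})" by auto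
  finally show "convex (face S)"
    using convex_P by (auto intro!: convex_Int convex_INT convex_hyperplane)
  fix a b x assume a: "a \<in> P" "b \<in> P" "x \<in> face S" "x \<in> open_segment a b"
  then obtain u where u: "0 < u" "u < 1" "x = (1 - u) *\<^sub>R a + u *\<^sub>R b"
    by (auto simp: in_segment)
  have eq: "a \<bullet> p J = e J \<and> b \<bullet> p J = e J" if "J \<in> S" for J
  proof -
    have J: "J \<in> B" "x \<bullet> p J = e J" using that assms a(3) by (auto simp: face_def tight_def)
    have ab: "e J \<le> a \<bullet> p J" "e J \<le> b \<bullet> p J" using a J by (auto simp: P_def)
    \<comment> \<open>A convex combination with positive weights of nonnegative slacks vanishes only
      if both slacks do.\<close>
    have "(1 - u) * (a \<bullet> p J - e J) + u * (b \<bullet> p J - e J) = 0"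
      using J(2) u by (simp add: inner_add_left algebra_simps)
    moreover have "0 \<le> (1 - u) * (a \<bullet> p J - e J)" "0 \<le> u * (b \<bullet> p J - e J)" using ab u by auto
    ultimately have "(1 - u) * (a \<bullet> p J - e J) = 0" "u * (b \<bullet> p J - e J) = 0" by linarith+
    then show ?thesis using u by auto
  qed
  show "a \<in> face S" "b \<in> face S" using a eq assms by (auto simp: face_def tight_def)
qed

lemma face_face_tight:
  assumes F: "F face_of P" and "F \<noteq> {}"
  obtains x where "x \<in> F" "x \<in> P" "F = face (tight x)"
proof -
  have FP: "F \<subseteq> P" and cF: "convex F"
    using F by (auto simp: face_of_imp_subset face_of_imp_convex)
  \<comment> \<open>A point with the fewest tight constraints replaces a relative interior point of
    F: the midpoint with any y in F is tight only where both are, so minimality forces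
    \<open>tight x \<subseteq> tight y\<close>.\<close>
  obtain x where x: "x \<in> F" "\<And>y. y \<in> F \<Longrightarrow> card (tight x) \<le> card (tight y)"
    using ex_has_least_nat[of "\<lambda>x. x \<in> F" _ "\<lambda>x. card (tight x)"] \<open>F \<noteq> {}\<close> by blast
  have xP: "x \<in> P" using x FP by blast
  have "F \<subseteq> face (tight x)"
  proof
    fix y assume y: "y \<in> F"
    define z where "z = (1/2) *\<^sub>R x + (1/2) *\<^sub>R y"
    have zF: "z \<in> F" using cF x(1) y unfolding z_def convex_def by simp
    have yP: "y \<in> P" using y FP by blast
    have "tight z \<subseteq> tight x \<inter> tight y"
    proof
      fix J assume "J \<in> tight z"
      then have J: "J \<in> B" "(1/2) * (x \<bullet> p J) + (1/2) * (y \<bullet> p J) = e J"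
        by (auto simp: tight_def z_def inner_add_left)
      moreover have "e J \<le> x \<bullet> p J" "e J \<le> y \<bullet> p J" using xP yP J by (auto simp: P_def)
      ultimately have "x \<bullet> p J = e J" "y \<bullet> p J = e J" by argo+
      then show "J \<in> tight x \<inter> tight y" using J by (simp add: tight_def)
    qed
    moreover have "finite (tight x)" using finite_building by (simp add: tight_def)
    ultimately have "tight z = tight x" using x(2)[OF zF] by (metis card_seteq le_inf_iff)
    then show "y \<in> face (tight x)" using \<open>tight z \<subseteq> _\<close> yP by (auto simp: face_def)
  qed
  moreover have "face (tight x) \<subseteq> F"
  proof
    fix y assume "y \<in> face (tight x)"
    then have y: "y \<in> P" "tight x \<subseteq> tight y" by (auto simp: face_def)
    show "y \<in> F"
    proof (cases "y = x")
      case False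
      \<comment> \<open>The segment from y to x can be prolonged beyond x within P, since d is
        orthogonal to all vectors tight at x. Then x is interior to a segment starting at y, and the
        face property puts y into F. As \<open>z - y = (1 + s) *\<^sub>R d\<close>, the weight of z
        is \<open>1 / (1 + s)\<close>.\<close>
      define d where "d = x - y"
      have d0: "d \<bullet> p J = 0" if "J \<in> tight x" for J
      proof -
        have "J \<in> tight y" using that y by blast
        then show ?thesis using that by (simp add: d_def tight_def inner_diff_left)
      qed
      obtain s where s: "0 < s" "x + s *\<^sub>R d \<in> P"
      proof (rule perturb[OF xP, of d])
        show "0 \<le> d \<bullet> p J" if "J \<in> tight x" for J using d0[OF that] by simp
        show "d \<bullet> p I = 0" using d0 nest_tight(2)[OF xP] by blast
      qed
      define z where "z = x + s *\<^sub>R d"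
      have "x = (1 - 1 / (1 + s)) *\<^sub>R y + (1 / (1 + s)) *\<^sub>R z"
      proof -
        have "(1 + s) *\<^sub>R x = s *\<^sub>R y + z" by (simp add: z_def d_def algebra_simps)
        then have "(1 / (1 + s)) *\<^sub>R ((1 + s) *\<^sub>R x) = (1 / (1 + s)) *\<^sub>R (s *\<^sub>R y + z)" by simp
        then have "x = (s / (1 + s)) *\<^sub>R y + (1 / (1 + s)) *\<^sub>R z"
          using s(1) by (simp add: scaleR_add_right)
        moreover have "s / (1 + s) = 1 - 1 / (1 + s)" using s(1) by (simp add: field_simps)
        ultimately show ?thesis by simp
      qed
      moreover have "z \<noteq> y"
      proof
        assume "z = y"
        then have "(1 + s) *\<^sub>R d = 0" by (simp add: z_def d_def algebra_simps)
        then show False using s(1) False by (simp add: d_def)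
      qed
      ultimately have "x \<in> open_segment y z"
        using s(1) unfolding in_segment by (intro conjI exI[of _ "1 / (1 + s)"]) auto
      then show ?thesis
        using face_ofD[OF F, of x y z] x(1) y(1) s(2) by (auto simp: z_def)
    qed (use x in simp)
  qed
  ultimately show thesis using that x(1) xP by blast
qed

text \<open>A point of P whose tight set is exactly S decides the forward direction.\<close>

lemma face_subset_iff:
  assumes "nest S" "I \<in> S" "nest T"
  shows "face S \<subseteq> face T \<longleftrightarrow> T \<subseteq> S"
proof
  assume sub: "face S \<subseteq> face T"
  obtain x where x: "x \<in> P" "tight x = S" using nest_realized[OF assms(1,2)] .
  then have "x \<in> face T" using sub by (auto simp: face_def)
  then show "T \<subseteq> S" using x by (simp add: face_def)
qed (auto simp: face_def)

lemma nonempty_faces_P: "nonempty_faces P = face ` {S. nest S \<and> I \<in> S}"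
proof
  show "nonempty_faces P \<subseteq> face ` {S. nest S \<and> I \<in> S}"
  proof
    fix F assume "F \<in> nonempty_faces P"
    then have F: "F face_of P" "F \<noteq> {}" by (auto simp: nonempty_faces_def)
    obtain x where "x \<in> P" "F = face (tight x)" by (rule face_face_tight[OF F])
    then show "F \<in> face ` {S. nest S \<and> I \<in> S}" using nest_tight[of x] by blast
  qed
  show "face ` {S. nest S \<and> I \<in> S} \<subseteq> nonempty_faces P"
  proof
    fix F assume "F \<in> face ` {S. nest S \<and> I \<in> S}"
    then obtain S where S: "F = face S" "nest S" "I \<in> S" by blast
    obtain x where "x \<in> P" "tight x = S" using nest_realized[OF S(2,3)] .
    then have "x \<in> F" using S by (simp add: face_def)
    moreover have "F face_of P" using S face_face_of[of S] by (simp add: nest_def)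
    ultimately show "F \<in> nonempty_faces P" by (auto simp: nonempty_faces_def)
  qed
qed

lemma face_bij: "bij_betw face {S. nest S \<and> I \<in> S} (nonempty_faces P)"
  unfolding bij_betw_def nonempty_faces_P
proof
  show "inj_on face {S. nest S \<and> I \<in> S}"
  proof (rule inj_onI)
    fix S T assume *: "S \<in> {S. nest S \<and> I \<in> S}" "T \<in> {S. nest S \<and> I \<in> S}" "face S = face T"
    then show "S = T" using face_subset_iff[of S T] face_subset_iff[of T S] by simp
  qed
qed simp

text \<open>Near a point whose tight set is exactly S the other constraints are strict, so the face
  contains a nonempty relatively open piece of the affine space cut out by S. Independence gives
  that space codimension \<open>card S\<close>.\<close>

lemma aff_dim_face:
  assumes S: "nest S" "I \<in> S"
  shows "aff_dim (face S) = int (DIM('a)) - int (card S)"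
proof -
  obtain x where x: "x \<in> P" "tight x = S" using nest_realized[OF S] .
  define L where "L = {y. \<forall>J\<in>S. y \<bullet> p J = e J}"
  define U where "U = (\<Inter>J\<in>B - S. {y. p J \<bullet> y > e J})"
  have SB: "S \<subseteq> B" using S by (simp add: nest_def)
  have xS: "x \<bullet> p J = e J" if "J \<in> S" for J using that x(2) by (auto simp: tight_def)
  have "L = (\<lambda>y. x + y) ` {d. \<forall>v\<in>p ` S. d \<bullet> v = 0}"
  proof
    show "L \<subseteq> (\<lambda>y. x + y) ` {d. \<forall>v\<in>p ` S. d \<bullet> v = 0}"
    proof
      fix y assume "y \<in> L"
      then have "y - x \<in> {d. \<forall>v\<in>p ` S. d \<bullet> v = 0}" using xS by (simp add: L_def inner_diff_left)
      then show "y \<in> (\<lambda>y. x + y) ` {d. \<forall>v\<in>p ` S. d \<bullet> v = 0}"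
        by (intro image_eqI[of _ _ "y - x"]) auto
    qed
  qed (use xS in \<open>auto simp: L_def inner_add_left\<close>)
  then have "aff_dim L = aff_dim {d. \<forall>v\<in>p ` S. d \<bullet> v = 0}"
    by (simp add: aff_dim_translation_eq)
  also have "\<dots> = dim {d. \<forall>v\<in>p ` S. d \<bullet> v = 0}"
    by (rule aff_dim_subspace) (auto simp: subspace_def inner_add_left)
  also have "\<dots> = int (DIM('a)) - int (card S)"
    using dim_orthogonal_complement_of[OF nest_independent[OF S(1)]] card_image[OF nest_inj[OF S(1)]]
    by simp
  finally have L: "aff_dim L = int (DIM('a)) - int (card S)" .
  have "face S \<subseteq> L" by (auto simp: face_def L_def tight_def)
  moreover have "L \<inter> U \<subseteq> face S"
  proof
    fix y assume y: "y \<in> L \<inter> U"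
    then have "e J \<le> y \<bullet> p J" if "J \<in> B" for J
      using that by (cases "J \<in> S") (auto simp: L_def U_def inner_commute less_imp_le)
    then show "y \<in> face S"
      using y S(2) SB by (auto simp: face_def P_def L_def tight_def)
  qed
  moreover have "aff_dim (L \<inter> U) = aff_dim L"
  proof (rule aff_dim_convex_Int_open)
    have "L = (\<Inter>J\<in>S. {y. p J \<bullet> y = e J})" by (auto simp: L_def inner_commute)
    then show "convex L" by (auto intro!: convex_INT convex_hyperplane)
    show "open U" unfolding U_def
      using finite_building by (intro open_INT) (auto intro: open_halfspace_gt)
    have "x \<in> L" using xS by (simp add: L_def)
    moreover have "x \<in> U"
    proof -
      have "e J < p J \<bullet> x" if "J \<in> B - S" for J
        using that x by (force simp: P_def tight_def inner_commute)
      then show ?thesis by (simp add: U_def)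
    qed
    ultimately show "L \<inter> U \<noteq> {}" by blast
  qed
  ultimately show ?thesis using L by (metis aff_dim_subset order_antisym)
qed

section \<open>Vertices as extreme points\<close>

lemma card_max_nest_dim: "max_nest S \<Longrightarrow> card S = DIM('a)"
  using card_max_nest[of S] indep span_ground by (metis dim_UNIV dim_eq_card_independent dim_span)

lemma span_max_nest:
  assumes "max_nest S"
  shows "span (p ` S) = UNIV"
proof -
  have nS: "nest S" using assms by (simp add: max_nest_def)
  have "card (p ` S) = DIM('a)"
    using card_image[OF nest_inj[OF nS]] card_max_nest_dim[OF assms] by simp
  then show ?thesis
    using nest_independent[OF nS] by (metis card_eq_dim dim_UNIV finite_nest[OF nS] finite_imageI
      subset_UNIV top.extremum_unique)
qed

lemma max_nest_unique:
  assumes S: "max_nest S" and "\<And>A. A \<in> S \<Longrightarrow> x \<bullet> p A = e A" "\<And>A. A \<in> S \<Longrightarrow> y \<bullet> p A = e A"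
  shows "x = y"
proof -
  have "\<And>v. v \<in> p ` S \<Longrightarrow> orthogonal (x - y) v"
    using assms by (auto simp: orthogonal_def inner_diff_left)
  then have "orthogonal (x - y) (x - y)"
    using orthogonal_to_span[of "x - y" "p ` S" "x - y"] span_max_nest[OF S] by auto
  then show ?thesis by (simp add: orthogonal_self)
qed

lemma max_nest_point:
  assumes "max_nest S"
  shows "\<exists>!x. \<forall>A\<in>S. x \<bullet> p A = e A"
proof -
  have "nest S" using assms by (simp add: max_nest_def)
  then obtain x where "\<And>A. A \<in> S \<Longrightarrow> x \<bullet> p A = e A" using nest_solve[of S e] by blast
  then show ?thesis using max_nest_unique[OF assms] by (intro ex1I[of _ x]) blast+
qed

text \<open>An extreme point is a face of dimension 0, so its tight set has as many members as the
  space has dimensions. A maximal nested family extending it has the same size and therefore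
  coincides with it.\<close>

lemma extreme_points_P:
  "x extreme_point_of P \<longleftrightarrow> (\<exists>S. max_nest S \<and> (\<forall>A\<in>S. x \<bullet> p A = e A))"
proof
  assume x: "x extreme_point_of P"
  then have xf: "{x} face_of P" by (simp add: face_of_singleton)
  then have xP: "x \<in> P" using face_of_imp_subset by blast
  obtain y where y: "y \<in> {x}" "y \<in> P" "{x} = face (tight y)"
    by (rule face_face_tight[OF xf]) auto
  then have "aff_dim (face (tight x)) = 0" by (metis aff_dim_sing singletonD)
  then have ct: "card (tight x) = DIM('a)"
    using aff_dim_face[OF nest_tight[OF xP]] by simp
  obtain M where M: "max_nest M" "tight x \<subseteq> M" using max_nest_extend[OF nest_tight(1)[OF xP]] .
  then have "tight x = M"
    using card_max_nest_dim[OF M(1)] ct finite_nest[of M] by (metis card_subset_eq max_nest_def)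
  then show "\<exists>S. max_nest S \<and> (\<forall>A\<in>S. x \<bullet> p A = e A)" using M(1) by (auto simp: tight_def)
next
  assume "\<exists>S. max_nest S \<and> (\<forall>A\<in>S. x \<bullet> p A = e A)"
  then obtain S where S: "max_nest S" "\<And>A. A \<in> S \<Longrightarrow> x \<bullet> p A = e A" by blast
  note xP = max_nest_vertex[OF S]
  have SB: "S \<subseteq> B" using S by (simp add: max_nest_def nest_def)
  have "face S = {x}"
  proof
    show "face S \<subseteq> {x}"
    proof
      fix y assume "y \<in> face S"
      then have "\<And>A. A \<in> S \<Longrightarrow> y \<bullet> p A = e A" by (auto simp: face_def tight_def)
      then show "y \<in> {x}" using max_nest_unique[OF S(1) _ S(2)] by blast
    qed
    show "{x} \<subseteq> face S" using xP by (simp add: face_def)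
  qed
  then show "x extreme_point_of P" using face_face_of[OF SB] by (simp add: face_of_singleton)
qed

end

subsection \<open>Building sets of root subspaces\<close>

lemma direct_sum_of_unique:
  assumes C: "direct_sum_of C M" and M: "\<And>U. U \<in> M \<Longrightarrow> subspace U"
    and g: "\<And>U. U \<in> M \<Longrightarrow> g U \<in> U" and "(\<Sum>U\<in>M. g U) = 0" and "U \<in> M"
  shows "g U = 0"
proof -
  have inj: "inj_on (\<lambda>f. \<Sum>U\<in>M. f U) (PiE M (\<lambda>U. U))"
    using C by (simp add: direct_sum_of_def bij_betw_def)
  \<comment> \<open>Elements of \<open>PiE\<close> have a fixed value outside the index set, so g
    must be restricted before it can be compared with the zero family.\<close>
  have "restrict g M = (\<lambda>U\<in>M. 0)"
    by (rule inj_onD[OF inj]) (use assms in \<open>auto simp: subspace_0\<close>)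
  then show ?thesis using \<open>U \<in> M\<close> by (metis restrict_apply')
qed

lemma direct_sum_of_disjoint:
  assumes "finite M" "direct_sum_of C M" "\<And>U. U \<in> M \<Longrightarrow> subspace U"
    and "U \<in> M" "U' \<in> M" "v \<in> U" "v \<in> U'" "v \<noteq> 0"
  shows "U = U'"
proof (rule ccontr)
  assume "U \<noteq> U'"
  define g where "g W = (if W = U then v else if W = U' then - v else 0)" for W
  have "(\<Sum>W\<in>M. g W) = (\<Sum>W\<in>{U, U'}. g W)"
    by (rule sum.mono_neutral_right[OF assms(1)]) (use assms in \<open>auto simp: g_def\<close>)
  also have "\<dots> = 0" using \<open>U \<noteq> U'\<close> by (simp add: g_def)
  finally have "(\<Sum>W\<in>M. g W) = 0" .
  have "g W \<in> W" if "W \<in> M" for W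
    using assms(3)[OF that] assms(6,7) by (auto simp: g_def subspace_0 subspace_neg)
  from direct_sum_of_unique[OF assms(2,3) this \<open>(\<Sum>W\<in>M. g W) = 0\<close> assms(4)]
  have "g U = 0" .
  then show False using assms(8) by (simp add: g_def)
qed

locale root_building_set =
  fixes \<Phi> \<Delta> :: "'a::euclidean_space set" and G :: "'a set set" and \<epsilon> :: "nat \<Rightarrow> real" and a :: real
  assumes roots: "root_system \<Phi>" and simple: "simple_roots \<Phi> \<Delta>"
    and building: "building_set \<Phi> G" and UNIV_mem: "UNIV \<in> G"
    and suitable: "suitable_list \<Phi> \<Delta> G \<epsilon> a"
begin

text \<open>Fundamental elements of G are encoded by their sets of simple roots. Under
  \<open>span\<close>, cardinality becomes dimension and union becomes sum.\<close>

definition B :: "'a set set" where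
  "B = {J. J \<subseteq> \<Delta> \<and> span J \<in> G}"

definition half :: "'a set \<Rightarrow> 'a" where
  "half J = half_sum \<Phi> \<Delta> (span J)"

definition c :: "'a set \<Rightarrow> 'a \<Rightarrow> real" where
  "c J i = representation \<Delta> (half J) i"

section \<open>Expansions in simple roots\<close>

lemma finite_roots: "finite \<Phi>"
  and simple_subset: "\<Delta> \<subseteq> \<Phi>"
  and indep_simple: "independent \<Delta>"
  and span_simple: "span \<Delta> = UNIV"
  using roots simple by (auto simp: root_system_def simple_roots_def)

lemma finite_simple: "finite \<Delta>"
  using finite_roots simple_subset finite_subset by blast

lemma card_simple: "card \<Delta> = DIM('a)"
  using indep_simple span_simple by (metis dim_UNIV dim_eq_card_independent dim_span)

lemma root_nonzero: "\<beta> \<in> \<Phi> \<Longrightarrow> \<beta> \<noteq> 0"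
  using roots by (auto simp: root_system_def)

lemma root_reflection_mem: "\<alpha> \<in> \<Phi> \<Longrightarrow> \<beta> \<in> \<Phi> \<Longrightarrow> root_reflection \<alpha> \<beta> \<in> \<Phi>"
  using roots unfolding root_system_def by blast

abbreviation rep :: "'a \<Rightarrow> 'a \<Rightarrow> real" where
  "rep \<equiv> representation \<Delta>"

lemma rep_add: "rep (x + y) i = rep x i + rep y i"
  and rep_diff: "rep (x - y) i = rep x i - rep y i"
  and rep_scale: "rep (r *\<^sub>R x) i = r * rep x i"
  by (simp_all add: indep_simple span_simple representation_add representation_diff
      representation_scale)

lemma rep_sum: "rep (\<Sum>s\<in>S. g s) i = (\<Sum>s\<in>S. rep (g s) i)"
  by (simp add: indep_simple span_simple representation_sum)

lemma rep_simple: "j \<in> \<Delta> \<Longrightarrow> rep j i = (if i = j then 1 else 0)"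
  by (simp add: indep_simple representation_basis)

lemma rep_expand: "(\<Sum>i\<in>\<Delta>. rep x i *\<^sub>R i) = x"
  using sum_representation_eq[OF indep_simple, of x \<Delta>] span_simple finite_simple by simp

lemma rep_outside:
  assumes "J \<subseteq> \<Delta>" "x \<in> span J" "i \<notin> J"
  shows "rep x i = 0"
proof -
  have "rep x = representation J x"
    by (rule representation_extend[OF indep_simple assms(2,1)])
  then show ?thesis using representation_ne_zero[of J x i] assms(3) by auto
qed

lemma rep_inner:
  assumes "J \<subseteq> \<Delta>" "x \<in> span J"
  shows "y \<bullet> x = (\<Sum>i\<in>J. rep x i * (y \<bullet> i))"
proof -
  have "y \<bullet> x = y \<bullet> (\<Sum>i\<in>\<Delta>. rep x i *\<^sub>R i)" by (simp add: rep_expand)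
  also have "\<dots> = (\<Sum>i\<in>\<Delta>. rep x i * (y \<bullet> i))" by (simp add: inner_sum_right)
  also have "\<dots> = (\<Sum>i\<in>J. rep x i * (y \<bullet> i))"
    using finite_simple assms rep_outside[OF assms] by (intro sum.mono_neutral_right) auto
  finally show ?thesis .
qed

lemma span_Int_simple: "J \<subseteq> \<Delta> \<Longrightarrow> \<Delta> \<inter> span J = J"
proof -
  assume J: "J \<subseteq> \<Delta>"
  have "i \<in> J" if "i \<in> \<Delta>" "i \<in> span J" for i
  proof (rule ccontr)
    assume "i \<notin> J"
    then have "rep i i = 0" by (rule rep_outside[OF J that(2)])
    then show False using rep_simple[OF that(1)] by simp
  qed
  then show ?thesis using J span_base by blast
qed

lemma span_subset_iff: "J \<subseteq> \<Delta> \<Longrightarrow> K \<subseteq> \<Delta> \<Longrightarrow> span J \<subseteq> span K \<longleftrightarrow> J \<subseteq> K"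
  using span_Int_simple span_mono by blast

lemma dim_span_simple: "J \<subseteq> \<Delta> \<Longrightarrow> dim (span J) = card J"
  using independent_mono[OF indep_simple] by (simp add: dim_eq_card_independent)

lemma finite_positive: "finite (positive_roots \<Phi> \<Delta>)"
  using finite_roots by (simp add: positive_roots_def)

lemma c_eq: "c J i = (\<Sum>\<beta>\<in>positive_roots \<Phi> \<Delta> \<inter> span J. rep \<beta> i) / 2"
  by (simp add: c_def half_def half_sum_def rep_scale rep_sum)

lemma rep_positive: "\<beta> \<in> positive_roots \<Phi> \<Delta> \<Longrightarrow> 0 \<le> rep \<beta> i"
  using representation_ne_zero[of \<Delta> \<beta> i] by (force simp: positive_roots_def)

text \<open>A larger span collects more positive roots, and none of them has a negative
  coefficient.\<close>

lemma c_mono: "J \<subseteq> K \<Longrightarrow> c J i \<le> c K i"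
  unfolding c_eq using span_mono[of J K] finite_positive
  by (intro divide_right_mono sum_mono2) (auto intro: rep_positive)

lemma half_span: "half J \<in> span J"
  unfolding half_def half_sum_def by (intro span_scale span_sum) simp

lemma inner_half: "J \<subseteq> \<Delta> \<Longrightarrow> x \<bullet> half J = (\<Sum>i\<in>J. c J i * (x \<bullet> i))"
  unfolding c_def by (rule rep_inner[OF _ half_span])

lemma c_outside: "J \<subseteq> \<Delta> \<Longrightarrow> i \<notin> J \<Longrightarrow> c J i = 0"
  unfolding c_def by (rule rep_outside[OF _ half_span])

lemma simple_positive: "i \<in> \<Delta> \<Longrightarrow> i \<in> positive_roots \<Phi> \<Delta>"
  using simple_subset by (auto simp: positive_roots_def rep_simple)

lemma c_pos:
  assumes "J \<subseteq> \<Delta>" "i \<in> J"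
  shows "0 < c J i"
proof -
  have i: "i \<in> \<Delta>" using assms by blast
  have "rep i i \<le> (\<Sum>\<beta>\<in>positive_roots \<Phi> \<Delta> \<inter> span J. rep \<beta> i)"
    using finite_positive simple_positive[OF i] assms(2)
    by (intro member_le_sum) (auto intro: rep_positive span_base)
  then show ?thesis using rep_simple[OF i] by (simp add: c_eq)
qed

lemma c_nonneg: "J \<subseteq> \<Delta> \<Longrightarrow> 0 \<le> c J i"
  using c_pos c_outside by (metis less_eq_real_def)

section \<open>The building set on the simple roots\<close>

lemma subspace_mem: "U \<in> G \<Longrightarrow> subspace U"
  using building unfolding building_set_def root_subspaces_def by blast

lemma finite_G: "finite G"
proof -
  have "G \<subseteq> span ` Pow \<Phi>"
    using building unfolding building_set_def root_subspaces_def by blast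
  then show ?thesis using finite_roots by (meson finite_Pow_iff finite_imageI finite_subset)
qed

lemma maximal_in_extend:
  assumes "U \<in> G" "U \<subseteq> C"
  obtains M where "M \<in> maximal_in G C" "U \<subseteq> M"
proof -
  have "finite {W \<in> G. W \<subseteq> C}" using finite_G by simp
  from finite_has_maximal2[OF this, of U] assms
  obtain M where "M \<in> G" "M \<subseteq> C" "U \<subseteq> M" "\<And>W. W \<in> G \<Longrightarrow> W \<subseteq> C \<Longrightarrow> M \<subseteq> W \<Longrightarrow> M = W" by auto
  then have "M \<in> maximal_in G C" unfolding maximal_in_def by blast
  then show thesis using that \<open>U \<subseteq> M\<close> by blast
qed

lemma maximal_in_direct:
  assumes "S \<subseteq> \<Phi>" "S \<noteq> {}"
  shows "direct_sum_of (span S) (maximal_in G (span S))"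
    and "finite (maximal_in G (span S))" and "\<And>U. U \<in> maximal_in G (span S) \<Longrightarrow> subspace U"
proof -
  have "span S \<in> root_subspaces \<Phi>" using assms unfolding root_subspaces_def by blast
  then show "direct_sum_of (span S) (maximal_in G (span S))"
    using building unfolding building_set_def by blast
qed (use finite_G subspace_mem in \<open>auto simp: maximal_in_def\<close>)

lemma maximal_in_disjoint:
  assumes S: "S \<subseteq> \<Phi>" "S \<noteq> {}" and U: "U \<in> maximal_in G (span S)" "U' \<in> maximal_in G (span S)"
    and v: "v \<in> U" "v \<in> U'" "v \<noteq> 0"
  shows "U = U'"
  by (rule direct_sum_of_disjoint[OF maximal_in_direct(2,1)[OF S] _ U v])
    (rule maximal_in_direct(3)[OF S])

lemma B_empty: "{} \<notin> B"
proof
  assume "{} \<in> B"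
  then have "{0} \<in> G" by (simp add: B_def)
  then have "{0} \<in> root_subspaces \<Phi>" using building unfolding building_set_def by (meson subsetD)
  then obtain S where S: "S \<subseteq> \<Phi>" "S \<noteq> {}" "{0} = span S"
    unfolding root_subspaces_def by (elim CollectE exE conjE)
  from S(2) obtain \<beta> where "\<beta> \<in> S" by (meson ex_in_conv)
  then have "\<beta> \<in> {0}" unfolding S(3) by (rule span_base)
  then show False using root_nonzero[of \<beta>] S(1) \<open>\<beta> \<in> S\<close> by auto
qed

lemma line_mem: "\<beta> \<in> \<Phi> \<Longrightarrow> span {\<beta>} \<in> G"
  using building unfolding building_set_def by (elim conjE) (rule bspec)

lemma B_singleton: "i \<in> \<Delta> \<Longrightarrow> {i} \<in> B"
  using line_mem[of i] simple_subset by (simp add: B_def subset_iff)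

text \<open>In the decomposition of \<open>span (J \<union> K)\<close> the summands containing
  \<open>span J\<close> and \<open>span K\<close> share the nonzero vector i, so they coincide. This
  one summand contains J and K and is therefore the whole space.\<close>

lemma B_Un:
  assumes "J \<in> B" "K \<in> B" "J \<inter> K \<noteq> {}"
  shows "J \<union> K \<in> B"
proof -
  obtain i where i: "i \<in> J" "i \<in> K" using assms(3) by blast
  have JK: "J \<subseteq> \<Delta>" "K \<subseteq> \<Delta>" "span J \<in> G" "span K \<in> G" using assms by (auto simp: B_def)
  have S: "J \<union> K \<subseteq> \<Phi>" "J \<union> K \<noteq> {}" using JK simple_subset i by auto
  let ?C = "span (J \<union> K)"
  have sub: "span J \<subseteq> ?C" "span K \<subseteq> ?C" by (simp_all add: span_mono)
  obtain M where M: "M \<in> maximal_in G ?C" "span J \<subseteq> M" by (rule maximal_in_extend[OF JK(3) sub(1)])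
  obtain N where N: "N \<in> maximal_in G ?C" "span K \<subseteq> N" by (rule maximal_in_extend[OF JK(4) sub(2)])
  have "i \<in> M" "i \<in> N" using M(2) N(2) span_base[OF i(1)] span_base[OF i(2)] by auto
  moreover have "i \<noteq> 0" using root_nonzero[of i] i S(1) by auto
  ultimately have "M = N"
    by (rule maximal_in_disjoint[OF S M(1) N(1)])
  moreover have "J \<subseteq> M" "K \<subseteq> N" using M(2) N(2) span_superset by (meson order_trans)+
  ultimately have "J \<union> K \<subseteq> M" by simp
  then have "?C \<subseteq> M" using maximal_in_direct(3)[OF S M(1)] by (rule span_minimal)
  then have "M = ?C" "M \<in> G" using M(1) by (auto simp: maximal_in_def)
  then show ?thesis using JK by (simp add: B_def)
qed

text \<open>
  For non-orthogonal \<open>i\<close> and \<open>j\<close> the reflection of \<open>j\<close> in \<open>i\<close> is a root with nonzero components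
  along both, so it cannot lie in any summand of a decomposition that separates \<open>i\<close> from \<open>j\<close>.
\<close>

lemma B_edge:
  assumes i: "i \<in> \<Delta>" and j: "j \<in> \<Delta>" and ij: "i \<bullet> j \<noteq> 0"
  shows "{i, j} \<in> B"
proof -
  have S: "{i, j} \<subseteq> \<Phi>" "{i, j} \<noteq> {}" using i j simple_subset by auto
  let ?C = "span {i, j}"
  note dir = maximal_in_direct[OF S]
  have lines: "\<exists>M. M \<in> maximal_in G ?C \<and> \<beta> \<in> M" if "\<beta> \<in> \<Phi>" "\<beta> \<in> ?C" for \<beta>
  proof -
    have "span {\<beta>} \<in> G" using that by (intro line_mem)
    moreover have "span {\<beta>} \<subseteq> ?C" using that by (simp add: span_minimal)
    ultimately obtain M where "M \<in> maximal_in G ?C" "span {\<beta>} \<subseteq> M" by (rule maximal_in_extend)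
    then show ?thesis using span_base[of \<beta> "{\<beta>}"] by blast
  qed
  define k where "k = 2 * (j \<bullet> i) / (i \<bullet> i)"
  have nz: "i \<noteq> 0" "j \<noteq> 0" using S root_nonzero by auto
  have "k \<noteq> 0" using ij nz by (simp add: k_def inner_commute)
  define \<gamma> where "\<gamma> = j - k *\<^sub>R i"
  have \<gamma>: "\<gamma> \<in> \<Phi>"
    using root_reflection_mem[of i j] S by (simp add: root_reflection_def \<gamma>_def k_def)
  have \<gamma>C: "\<gamma> \<in> ?C" unfolding \<gamma>_def by (intro span_diff span_scale) (auto intro: span_base)
  obtain M1 where M1: "M1 \<in> maximal_in G ?C" "i \<in> M1" using lines[of i] S by (auto intro: span_base)
  obtain M2 where M2: "M2 \<in> maximal_in G ?C" "j \<in> M2" using lines[of j] S by (auto intro: span_base)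
  obtain M3 where M3: "M3 \<in> maximal_in G ?C" "\<gamma> \<in> M3" using lines \<gamma> \<gamma>C by blast
  have sub: "subspace M1" "subspace M2" "subspace M3" using dir(3) M1 M2 M3 by auto
  have "M1 = M2"
  proof (rule ccontr)
    assume ne: "M1 \<noteq> M2"
    have disj: "U = U'" if "U \<in> maximal_in G ?C" "U' \<in> maximal_in G ?C" "v \<in> U" "v \<in> U'" "v \<noteq> 0"
      for U U' v
      by (rule maximal_in_disjoint[OF S that])
    have "M3 \<noteq> M1"
    proof
      assume "M3 = M1"
      then have "\<gamma> + k *\<^sub>R i \<in> M1" using M1 M3 sub by (intro subspace_add subspace_scale) auto
      then have "j \<in> M1" by (simp add: \<gamma>_def)
      then show False using disj[OF M1(1) M2(1), of j] M2 nz ne by blast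
    qed
    moreover have "M3 \<noteq> M2"
    proof
      assume "M3 = M2"
      then have "(1 / k) *\<^sub>R (j - \<gamma>) \<in> M2" using M2 M3 sub by (intro subspace_diff subspace_scale) auto
      then have "i \<in> M2" using \<open>k \<noteq> 0\<close> by (simp add: \<gamma>_def)
      then show False using disj[OF M1(1) M2(1), of i] M1 nz ne by blast
    qed
    ultimately have ne3: "M3 \<noteq> M1" "M3 \<noteq> M2" by auto
    \<comment> \<open>The relation \<open>- k *\<^sub>R i + j - \<gamma> = 0\<close>, with its three
      terms in three different summands, contradicts directness.\<close>
    define g where
      "g U = (if U = M1 then - k *\<^sub>R i else if U = M2 then j else if U = M3 then - \<gamma> else 0)" for U
    have "(\<Sum>U\<in>maximal_in G ?C. g U) = (\<Sum>U\<in>{M1, M2, M3}. g U)"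
      by (rule sum.mono_neutral_right[OF dir(2)]) (use M1 M2 M3 in \<open>auto simp: g_def\<close>)
    also have "\<dots> = 0" using ne ne3 ne3[symmetric] by (simp add: g_def \<gamma>_def)
    finally have zero: "(\<Sum>U\<in>maximal_in G ?C. g U) = 0" .
    have "g M2 = 0"
    proof (rule direct_sum_of_unique[OF dir(1,3) _ zero M2(1)])
      show "g U \<in> U" if "U \<in> maximal_in G ?C" for U
        using M1 M2 M3 sub dir(3)[OF that]
        by (auto simp: g_def subspace_0 subspace_neg subspace_scale)
    qed
    then show False using ne nz by (simp add: g_def)
  qed
  then have "?C \<subseteq> M1" using M1 M2 sub by (intro span_minimal) auto
  then have "M1 = ?C" "M1 \<in> G" using M1 by (auto simp: maximal_in_def)
  then show ?thesis using i j by (simp add: B_def)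
qed

lemma B_join:
  assumes "J \<in> B" "K \<in> B" "i \<in> J" "j \<in> K" "i \<bullet> j \<noteq> 0"
  shows "J \<union> K \<in> B"
proof -
  have "i \<in> \<Delta>" "j \<in> \<Delta>" using assms by (auto simp: B_def)
  then have "{i, j} \<in> B" using assms(5) by (rule B_edge)
  then have "J \<union> {i, j} \<in> B" using B_Un[of J "{i, j}"] assms by blast
  then have "(J \<union> {i, j}) \<union> K \<in> B" using B_Un[of "J \<union> {i, j}" K] assms by blast
  moreover have "(J \<union> {i, j}) \<union> K = J \<union> K" using assms by blast
  ultimately show ?thesis by simp
qed

lemma finite_building_set_B: "finite_building_set \<Delta> B"
proof
  show "\<Delta> \<in> B" using UNIV_mem span_simple by (simp add: B_def)
qed (use finite_simple B_empty B_singleton B_Un in \<open>auto simp: B_def\<close>)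

text \<open>
  Reflections in \<open>J\<close> leave the \<open>K\<close>-part of a root unchanged. A root of minimal height among
  those with the \<open>K\<close>-part of \<open>\<beta>\<close> and a nonzero \<open>J\<close>-part could be lowered further.
\<close>

lemma positive_root_splits:
  assumes J: "J \<subseteq> \<Delta>" and K: "K \<subseteq> \<Delta>" and "J \<inter> K = {}"
    and orth: "\<And>i j. i \<in> J \<Longrightarrow> j \<in> K \<Longrightarrow> i \<bullet> j = 0"
    and \<beta>: "\<beta> \<in> positive_roots \<Phi> \<Delta>" "\<beta> \<in> span (J \<union> K)"
  shows "\<beta> \<in> span J \<or> \<beta> \<in> span K"
proof (rule ccontr)
  assume contra: "\<not> ?thesis"
  obtain b1 b2 where b: "b1 \<in> span J" "b2 \<in> span K" "\<beta> = b1 + b2"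
    using \<beta>(2) by (auto simp: span_Un)
  have "b1 \<noteq> 0" "b2 \<noteq> 0" using contra b by auto
  define R where "R = {\<gamma> \<in> \<Phi>. \<gamma> - b2 \<in> span J \<and> \<gamma> \<noteq> b2}"
  have "\<beta> \<in> R" using \<beta> b \<open>b1 \<noteq> 0\<close> by (simp add: R_def positive_roots_def)
  define h where "h \<gamma> = (\<Sum>i\<in>\<Delta>. rep \<gamma> i)" for \<gamma>
  have finR: "finite R" using finite_roots by (simp add: R_def)
  define \<gamma> where "\<gamma> = arg_min_on h R"
  have \<gamma>: "\<gamma> \<in> R" "\<And>\<gamma>'. \<gamma>' \<in> R \<Longrightarrow> h \<gamma> \<le> h \<gamma>'"
    using arg_min_if_finite[OF finR, of h] \<open>\<beta> \<in> R\<close> by (force simp: \<gamma>_def)+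
  define u where "u = \<gamma> - b2"
  have u: "u \<in> span J" "u \<noteq> 0" "\<gamma> \<in> \<Phi>" using \<gamma>(1) by (auto simp: R_def u_def)
  \<comment> \<open>A coordinate of the common K-part fixes the sign: it is positive in \<beta>, so
    \<gamma> has a positive coefficient there and is a positive root as well.\<close>
  obtain k where k: "k \<in> K" "rep b2 k \<noteq> 0"
  proof -
    have "\<exists>k\<in>K. rep b2 k \<noteq> 0"
    proof (rule ccontr)
      assume "\<not> ?thesis"
      then have "b2 \<bullet> b2 = 0" using rep_inner[OF K b(2), of b2] by simp
      then show False using \<open>b2 \<noteq> 0\<close> by simp
    qed
    then show thesis using that by blast
  qed
  have kJ: "k \<notin> J" and k\<Delta>: "k \<in> \<Delta>" using k assms by auto
  have "rep \<beta> k = rep b2 k" using b rep_outside[OF J b(1) kJ] by (simp add: rep_add)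
  then have "0 < rep b2 k" using rep_positive[OF \<beta>(1), of k] k by simp
  moreover have "rep \<gamma> k = rep b2 k"
    using rep_outside[OF J u(1) kJ] by (simp add: u_def rep_diff)
  ultimately have \<gamma>pos: "0 \<le> rep \<gamma> i" if "i \<in> \<Delta>" for i
    using simple u(3) k\<Delta> that unfolding simple_roots_def by force
  have upos: "0 \<le> rep u i" if "i \<in> J" for i
  proof -
    have "i \<notin> K" using that assms(3) by blast
    then have "rep u i = rep \<gamma> i" using rep_outside[OF K b(2)] by (simp add: u_def rep_diff)
    then show ?thesis using \<gamma>pos that J by auto
  qed
  \<comment> \<open>Since u is a nonnegative combination of J with positive norm, it cannot make a
    nonpositive inner product with all of J. Reflecting \<gamma> in this i lowers its
    height.\<close>
  obtain i where i: "i \<in> J" "0 < u \<bullet> i"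
  proof -
    have "\<exists>i\<in>J. 0 < u \<bullet> i"
    proof (rule ccontr)
      assume "\<not> ?thesis"
      then have "u \<bullet> u \<le> 0"
        unfolding rep_inner[OF J u(1), of u]
        by (intro sum_nonpos mult_nonneg_nonpos upos) (auto simp: not_less)
      then show False using u(2) by (simp add: inner_gt_zero_iff flip: not_less)
    qed
    then show thesis using that by blast
  qed
  have i\<Delta>: "i \<in> \<Delta>" using i J by blast
  have ii: "0 < i \<bullet> i" using root_nonzero simple_subset i\<Delta> by (auto simp: inner_gt_zero_iff)
  have "orthogonal i b2"
    using orthogonal_to_span[OF b(2), of i] orth i(1) by (auto simp: orthogonal_def)
  then have \<gamma>i: "\<gamma> \<bullet> i = u \<bullet> i" by (simp add: u_def orthogonal_def inner_diff_left inner_commute[of i])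
  define t where "t = 2 * (u \<bullet> i) / (i \<bullet> i)"
  have t: "0 < t" using i ii by (simp add: t_def)
  define \<gamma>' where "\<gamma>' = \<gamma> - t *\<^sub>R i"
  have "\<gamma>' \<in> \<Phi>"
    using root_reflection_mem[of i \<gamma>] i\<Delta> simple_subset u(3)
    by (auto simp: root_reflection_def \<gamma>'_def t_def \<gamma>i)
  moreover have "\<gamma>' - b2 = u - t *\<^sub>R i" by (simp add: \<gamma>'_def u_def)
  moreover have "u - t *\<^sub>R i \<in> span J" using u i by (intro span_diff span_scale) (auto intro: span_base)
  \<comment> \<open>The reflection cannot annihilate the J-part: by the choice of t,
    \<open>u = t *\<^sub>R i\<close> would give
    \<open>u \<bullet> i = 2 * (u \<bullet> i)\<close>.\<close>
  moreover have "\<gamma>' \<noteq> b2"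
  proof
    assume "\<gamma>' = b2"
    then have "u = t *\<^sub>R i" by (simp add: \<gamma>'_def u_def algebra_simps)
    then have "u \<bullet> i = t * (i \<bullet> i)" by simp
    then show False using i ii by (simp add: t_def)
  qed
  ultimately have "\<gamma>' \<in> R" by (simp add: R_def)
  moreover have "h \<gamma>' = h \<gamma> - t"
  proof -
    have "h \<gamma>' = (\<Sum>j\<in>\<Delta>. rep \<gamma> j - t * (if j = i then 1 else 0))"
      unfolding h_def \<gamma>'_def using rep_simple[OF i\<Delta>] by (simp add: rep_diff rep_scale)
    also have "\<dots> = h \<gamma> - t * (\<Sum>j\<in>\<Delta>. if j = i then 1 else 0)"
      by (simp only: h_def sum_subtractf sum_distrib_left)
    also have "\<dots> = h \<gamma> - t" using finite_simple i\<Delta> by simp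
    finally show ?thesis .
  qed
  ultimately show False using \<gamma>(2) t by force
qed

text \<open>The positive roots of the union are those of J together with those of K; there is no
  double counting because the two spans meet only in 0.\<close>

lemma c_orthogonal_Un:
  assumes J: "J \<subseteq> \<Delta>" and K: "K \<subseteq> \<Delta>" and disj: "J \<inter> K = {}"
    and orth: "\<And>i j. i \<in> J \<Longrightarrow> j \<in> K \<Longrightarrow> i \<bullet> j = 0"
  shows "c (J \<union> K) i = c J i + c K i"
proof -
  let ?P = "positive_roots \<Phi> \<Delta>"
  have "?P \<inter> span (J \<union> K) = (?P \<inter> span J) \<union> (?P \<inter> span K)"
  proof
    show "?P \<inter> span (J \<union> K) \<subseteq> ?P \<inter> span J \<union> ?P \<inter> span K"
    proof
      fix x assume "x \<in> ?P \<inter> span (J \<union> K)"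
      then show "x \<in> ?P \<inter> span J \<union> ?P \<inter> span K"
        using positive_root_splits[OF J K disj orth, of x] by simp
    qed
    show "?P \<inter> span J \<union> ?P \<inter> span K \<subseteq> ?P \<inter> span (J \<union> K)"
      using span_mono[of J "J \<union> K"] span_mono[of K "J \<union> K"] by blast
  qed
  moreover have "(?P \<inter> span J) \<inter> (?P \<inter> span K) = {}"
  proof -
    have "x = 0" if "x \<in> span J" "x \<in> span K" for x
    proof -
      have "rep x i = 0" for i
        using rep_outside[OF J that(1), of i] rep_outside[OF K that(2), of i] disj
        by (cases "i \<in> J") auto
      then show ?thesis using rep_expand[of x] by simp
    qed
    moreover have "0 \<notin> positive_roots \<Phi> \<Delta>"
      using root_nonzero by (auto simp: positive_roots_def)
    ultimately show ?thesis by (metis Int_iff disjoint_iff)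
  qed
  ultimately show ?thesis
    unfolding c_eq using finite_positive
    by (metis (no_types, lifting) sum.union_disjoint add_divide_distrib finite_Int)
qed

end

subsection \<open>Consequences of suitability\<close>

context root_building_set
begin

text \<open>The maximum runs over all of \<Delta> to match the numerator of
  \<open>coeff_ratio\<close>; for nonempty \<open>J \<subseteq> \<Delta>\<close> the zero
  coefficients outside J do not affect it.\<close>

definition cmax :: "'a set \<Rightarrow> real" where
  "cmax J = Max (c J ` \<Delta>)"

definition cmin :: "'a set \<Rightarrow> real" where
  "cmin J = Min (c J ` J)"

definition e :: "'a set \<Rightarrow> real" where
  "e J = \<epsilon> (card J)"

definition weight :: "'a set \<Rightarrow> ('a \<Rightarrow> real) \<Rightarrow> real" where
  "weight J f = (\<Sum>i\<in>J. c J i * f i)"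

section \<open>Coefficient bounds and growth of the list\<close>

lemma B_subset: "J \<in> B \<Longrightarrow> J \<subseteq> \<Delta>"
  by (simp add: B_def)

lemma B_finite: "J \<in> B \<Longrightarrow> finite J"
  using B_subset finite_simple finite_subset by metis

lemma B_nonempty: "J \<in> B \<Longrightarrow> J \<noteq> {}"
  using B_empty by metis

lemma c_le_cmax: "i \<in> \<Delta> \<Longrightarrow> c J i \<le> cmax J"
  using finite_simple by (simp add: cmax_def)

lemma cmin_le_c: "J \<in> B \<Longrightarrow> i \<in> J \<Longrightarrow> cmin J \<le> c J i"
  using B_finite by (simp add: cmin_def)

lemma cmin_pos: "J \<in> B \<Longrightarrow> 0 < cmin J"
  using B_finite[of J] B_nonempty[of J] c_pos[OF B_subset] by (simp add: cmin_def)

lemma cmin_le_cmax: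
  assumes "K \<in> B" "L \<subseteq> \<Delta>" "K \<subseteq> L"
  shows "cmin K \<le> cmax L"
proof -
  obtain i where i: "i \<in> K" using B_nonempty[OF assms(1)] by auto
  have "cmin K \<le> c K i" using cmin_le_c[OF assms(1) i] .
  also have "\<dots> \<le> c L i" using c_mono[OF assms(3)] .
  also have "\<dots> \<le> cmax L" using c_le_cmax i assms by auto
  finally show ?thesis .
qed

lemma coeff_ratio_span: "K \<subseteq> \<Delta> \<Longrightarrow> coeff_ratio \<Phi> \<Delta> (span L) (span K) = cmax L / cmin K"
  by (simp add: coeff_ratio_def cmax_def cmin_def c_def half_def span_Int_simple)

lemma fund_eq: "fund \<Delta> G = span ` B"
  by (auto simp: fund_def B_def)

lemma coeff_ratios_eq:
  "coeff_ratios \<Phi> \<Delta> G i j =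
    {cmax L / cmin K | L K. L \<in> B \<and> K \<in> B \<and> K \<subset> L \<and> card L = i \<and> card K = j}"
proof -
  have "coeff_ratios \<Phi> \<Delta> G i j = {coeff_ratio \<Phi> \<Delta> (span L) (span K) | L K.
      L \<in> B \<and> K \<in> B \<and> span K \<subset> span L \<and> dim (span L) = i \<and> dim (span K) = j}"
    unfolding coeff_ratios_def fund_eq by blast
  also have "\<dots> = {cmax L / cmin K | L K. L \<in> B \<and> K \<in> B \<and> K \<subset> L \<and> card L = i \<and> card K = j}"
  proof -
    have "span K \<subset> span L \<longleftrightarrow> K \<subset> L" if "K \<in> B" "L \<in> B" for K L
      using span_subset_iff[of K L] span_subset_iff[of L K] B_subset that by (simp add: less_le_not_le)
    moreover have "dim (span L) = card L" if "L \<in> B" for L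
      using dim_span_simple[OF B_subset[OF that]] .
    moreover have "coeff_ratio \<Phi> \<Delta> (span L) (span K) = cmax L / cmin K" if "K \<in> B" for L K
      using coeff_ratio_span[OF B_subset[OF that]] .
    ultimately show ?thesis by (intro Collect_cong ex_cong1) (auto cong: conj_cong)
  qed
  finally show ?thesis .
qed

lemma finite_B: "finite B"
  using finite_building_set.finite_building[OF finite_building_set_B] .

lemma finite_coeff_ratios: "finite (coeff_ratios \<Phi> \<Delta> G i j)"
proof -
  have "coeff_ratios \<Phi> \<Delta> G i j \<subseteq> (\<lambda>(L, K). cmax L / cmin K) ` (B \<times> B)"
    unfolding coeff_ratios_eq by auto
  then show ?thesis using finite_B by (meson finite_SigmaI finite_imageI finite_subset)
qed

lemma ratio_le_max_ratio:
  assumes "L \<in> B" "K \<in> B" "K \<subset> L"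
  shows "cmax L / cmin K \<le> max_ratio \<Phi> \<Delta> G (card L) (card K)"
proof -
  have "cmax L / cmin K \<in> coeff_ratios \<Phi> \<Delta> G (card L) (card K)"
    unfolding coeff_ratios_eq using assms by blast
  then show ?thesis
    using finite_coeff_ratios by (auto simp: max_ratio_def)
qed

text \<open>A simple root common to K and L shows that no ratio falls below 1, and the value for an
  empty set of ratios is 1 too. Hence the list more than doubles at every step, even between
  dimensions without a pair.\<close>

lemma one_le_max_ratio: "1 \<le> max_ratio \<Phi> \<Delta> G i j"
proof (cases "coeff_ratios \<Phi> \<Delta> G i j = {}")
  case False
  then obtain L K where LK: "L \<in> B" "K \<in> B" "K \<subset> L" "card L = i" "card K = j"
    unfolding coeff_ratios_eq by auto
  have "1 \<le> cmax L / cmin K"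
    using cmin_le_cmax[OF LK(2) B_subset[OF LK(1)]] cmin_pos[OF LK(2)] LK(3) by (simp add: psubset_eq)
  also have "\<dots> \<le> max_ratio \<Phi> \<Delta> G i j" using ratio_le_max_ratio[OF LK(1-3)] LK by simp
  finally show ?thesis .
qed (simp add: max_ratio_def)

lemma eps_mono: "1 \<le> i \<Longrightarrow> i \<le> j \<Longrightarrow> j \<le> DIM('a) \<Longrightarrow> \<epsilon> i \<le> \<epsilon> j"
  using suitable strict_mono_on_imp_mono_on[of "{1..DIM('a)}" \<epsilon>]
  by (auto simp: suitable_list_def mono_on_def)

lemma eps_pos: "1 \<le> i \<Longrightarrow> i \<le> DIM('a) \<Longrightarrow> 0 < \<epsilon> i"
  using eps_mono[of 1 i] suitable by (simp add: suitable_list_def)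

lemma eps_step:
  assumes "1 \<le> j" "j < DIM('a)"
  shows "2 * max_ratio \<Phi> \<Delta> G (Suc j) j * \<epsilon> j < \<epsilon> (Suc j)"
proof -
  have "\<forall>i\<in>{2..DIM('a)}. 2 * max_ratio \<Phi> \<Delta> G i (i - 1) * \<epsilon> (i - 1) < \<epsilon> i"
    using suitable by (simp add: suitable_list_def)
  then show ?thesis using assms by (metis Suc_leI Suc_le_mono atLeastAtMost_iff diff_Suc_1
    numeral_2_eq_2 One_nat_def)
qed

lemma eps_double:
  assumes "1 \<le> j" "j < k" "k \<le> DIM('a)"
  shows "2 * \<epsilon> j < \<epsilon> k"
proof -
  have "2 * \<epsilon> j \<le> 2 * max_ratio \<Phi> \<Delta> G (Suc j) j * \<epsilon> j"
    using mult_right_mono[OF one_le_max_ratio[of "Suc j" j], of "2 * \<epsilon> j"] eps_pos[of j] assms by (simp add: algebra_simps)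
  also have "\<dots> < \<epsilon> (Suc j)" using eps_step assms by simp
  also have "\<dots> \<le> \<epsilon> k" using eps_mono[of "Suc j" k] assms by simp
  finally show ?thesis .
qed

text \<open>Each summand is less than half of the right-hand side. This superadditivity handles
  orthogonal unions, where weights simply add.\<close>

lemma eps_add:
  assumes "1 \<le> j" "1 \<le> k" "j + k \<le> DIM('a)"
  shows "\<epsilon> j + \<epsilon> k < \<epsilon> (j + k)"
  using eps_double[of j "j + k"] eps_double[of k "j + k"] assms by simp

lemma card_bounds: "J \<subseteq> \<Delta> \<Longrightarrow> J \<noteq> {} \<Longrightarrow> 1 \<le> card J \<and> card J \<le> DIM('a)"
  using card_mono[OF finite_simple, of J] card_simple finite_subset[OF _ finite_simple, of J]
  by (auto simp: Suc_le_eq card_gt_0_iff)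

lemma e_pos: "J \<in> B \<Longrightarrow> 0 < e J"
  using card_bounds[OF B_subset B_nonempty, of J] eps_pos by (simp add: e_def)

lemma e_double:
  assumes "J \<in> B" "K \<subseteq> \<Delta>" "J \<subset> K"
  shows "2 * e J < e K"
  using card_bounds[OF B_subset B_nonempty, of J] card_bounds[of K] assms
    psubset_card_mono[of K J] finite_subset[OF _ finite_simple, of K] eps_double[of "card J" "card K"]
  by (auto simp: e_def)

lemma e_mono:
  assumes "J \<in> B" "K \<subseteq> \<Delta>" "J \<subseteq> K"
  shows "e J \<le> e K"
  using e_double[OF assms(1,2)] e_pos[OF assms(1)] assms(3) by (cases "J = K") (auto simp: psubset_eq)

text \<open>For \<open>K \<subseteq> A\<close>: K is a union of connected components of the Coxeter
  diagram on A.\<close>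

definition closed_in :: "'a set \<Rightarrow> 'a set \<Rightarrow> bool" where
  "closed_in K A \<longleftrightarrow> (\<forall>i\<in>K. \<forall>j\<in>A - K. i \<bullet> j = 0)"

text \<open>
  Suitability only compares consecutive dimensions. Adjoining non-orthogonal simple roots one at
  a time links \<open>K\<close> to \<open>L\<close> by such comparisons, and the intermediate ratios are at least \<open>1\<close>.
\<close>

lemma closed_extension:
  assumes K: "K \<in> B" and A: "K \<subseteq> A" "A \<subseteq> \<Delta>"
  obtains L where "L \<in> B" "K \<subseteq> L" "L \<subseteq> A" "closed_in L A"
    "L = K \<or> 2 * (cmax L / cmin K) * e K < e L"
proof -
  \<comment> \<open>The case \<open>L = K\<close> is listed separately because the strict inequality
    fails there: its left side is at least \<open>2 * e K\<close>.\<close>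
  define F where
    "F = {L \<in> B. K \<subseteq> L \<and> L \<subseteq> A \<and> (L = K \<or> 2 * (cmax L / cmin K) * e K < e L)}"
  have "finite F" using finite_B by (simp add: F_def)
  moreover have "K \<in> F" using K A by (simp add: F_def)
  ultimately obtain L where L: "L \<in> F" "\<And>M. M \<in> F \<Longrightarrow> L \<subseteq> M \<Longrightarrow> L = M"
    using finite_has_maximal[of F] by (metis empty_iff)
  have LB: "L \<in> B" "K \<subseteq> L" "L \<subseteq> A" "L = K \<or> 2 * (cmax L / cmin K) * e K < e L"
    using L(1) by (simp_all add: F_def)
  have "closed_in L A"
    unfolding closed_in_def
  proof (intro ballI, rule ccontr)
    fix i j assume i: "i \<in> L" and j: "j \<in> A - L" and "i \<bullet> j \<noteq> 0"
    define M where "M = L \<union> {j}"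
    have MB: "M \<in> B"
      unfolding M_def using B_join[OF LB(1) B_singleton i, of j j] j A \<open>i \<bullet> j \<noteq> 0\<close> by auto
    have LM: "L \<subset> M" "card M = Suc (card L)" using j B_finite[OF LB(1)] by (auto simp: M_def)
    have b: "1 \<le> card L" "card L < DIM('a)"
      using card_bounds[OF B_subset B_nonempty, OF LB(1) LB(1)]
        card_bounds[OF B_subset B_nonempty, OF MB MB] LM by simp_all
    have "2 * (cmax M / cmin L) * e L \<le> 2 * max_ratio \<Phi> \<Delta> G (card M) (card L) * e L"
      using ratio_le_max_ratio[OF MB LB(1) LM(1)] e_pos[OF LB(1)] by (intro mult_right_mono) auto
    also have "\<dots> < e M" using eps_step[OF b] LM(2) by (simp add: e_def)
    finally have step: "2 * (cmax M / cmin L) * e L < e M" .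
    have "2 * (cmax M / cmin K) * e K < e M"
    proof (cases "L = K")
      case True
      then show ?thesis using step by simp
    next
      case False
      have q: "0 < cmin K" "0 < cmin L" "0 < cmax M" "cmin L \<le> cmax L"
        using cmin_pos K LB(1) cmin_le_cmax[OF LB(1) B_subset[OF MB]] cmin_le_cmax[OF LB(1) B_subset[OF LB(1)]] LM(1)
        by (auto simp: psubset_eq intro: less_le_trans)
      \<comment> \<open>The inserted factor \<open>cmax L / cmin L\<close>, which is at least 1,
        lets the bounds for the steps from K to L and from L to M telescope.\<close>
      have "2 * (cmax M / cmin K) * e K \<le> (cmax L / cmin L) * (2 * (cmax M / cmin K) * e K)"
      proof -
        have "1 \<le> cmax L / cmin L" using q by simp
        moreover have "0 \<le> 2 * (cmax M / cmin K) * e K" using q e_pos[OF K] by simp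
        ultimately show ?thesis using mult_right_mono[of 1 "cmax L / cmin L"] by fastforce
      qed
      also have "\<dots> = (cmax M / cmin L) * (2 * (cmax L / cmin K) * e K)" by simp
      also have "\<dots> \<le> (cmax M / cmin L) * e L"
        using LB(4) False q by (intro mult_left_mono) auto
      also have "\<dots> \<le> 2 * (cmax M / cmin L) * e L"
        using q e_pos[OF LB(1)] by (simp add: field_simps)
      also have "\<dots> < e M" by (rule step)
      finally show ?thesis .
    qed
    then have "M \<in> F" using MB LB LM(1) j by (auto simp: F_def M_def)
    then have "L = M" using L(2)[of M] LM(1) by (simp add: psubset_eq)
    then show False using LM(1) by simp
  qed
  then show thesis using that[of L] LB by simp
qed

section \<open>The key inequality for unions\<close>

lemma c_closed:
  assumes "K \<subseteq> A" "A \<subseteq> \<Delta>" "closed_in K A"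
  shows "c A i = c K i + c (A - K) i"
proof -
  have "c (K \<union> (A - K)) i = c K i + c (A - K) i"
    by (rule c_orthogonal_Un) (use assms in \<open>auto simp: closed_in_def\<close>)
  moreover have "K \<union> (A - K) = A" using assms(1) by blast
  ultimately show ?thesis by simp
qed

lemma weight_closed:
  assumes A: "K \<subseteq> A" "A \<subseteq> \<Delta>" "closed_in K A"
  shows "weight A f = weight K f + weight (A - K) f"
proof -
  have fin: "finite A" using A(2) finite_simple by (rule finite_subset)
  have "weight A f = (\<Sum>i\<in>K. c A i * f i) + (\<Sum>i\<in>A - K. c A i * f i)"
    unfolding weight_def using sum.subset_diff[OF A(1) fin, of "\<lambda>i. c A i * f i"] by simp
  moreover have "(\<Sum>i\<in>K. c A i * f i) = weight K f"
    unfolding weight_def using c_closed[OF A] c_outside[of "A - K"] A(2)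
    by (intro sum.cong) auto
  moreover have "(\<Sum>i\<in>A - K. c A i * f i) = weight (A - K) f"
    unfolding weight_def using c_closed[OF A] c_outside[of K] A
    by (intro sum.cong) auto
  ultimately show ?thesis by simp
qed

lemma weight_mono:
  assumes "J \<subseteq> K" "K \<subseteq> \<Delta>" "\<forall>i\<in>K. 0 \<le> f i"
  shows "weight J f \<le> weight K f"
proof -
  have fin: "finite K" using assms(2) finite_simple by (rule finite_subset)
  have "weight J f \<le> (\<Sum>i\<in>J. c K i * f i)"
    unfolding weight_def using c_mono[OF assms(1)] assms by (intro sum_mono mult_right_mono) auto
  also have "\<dots> \<le> weight K f"
    unfolding weight_def using c_nonneg[OF assms(2)] assms fin by (intro sum_mono2) auto
  finally show ?thesis .
qed

text \<open>The origin of the ratio in suitable lists: replacing the coefficients of K by their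
  minimum bounds the plain sum of f, which is then rescaled by a bound r on other
  coefficients.\<close>

lemma sum_le_weight:
  assumes "K \<in> B" "J \<subseteq> K" "\<forall>i\<in>K. 0 \<le> f i" "weight K f \<le> e K" "0 \<le> r"
  shows "(\<Sum>i\<in>J. r * f i) \<le> (r / cmin K) * e K"
proof -
  have q: "0 < cmin K" using cmin_pos[OF assms(1)] .
  have "cmin K * (\<Sum>i\<in>J. f i) \<le> (\<Sum>i\<in>K. cmin K * f i)"
    unfolding sum_distrib_left using assms q B_finite[OF assms(1)] by (intro sum_mono2) auto
  also have "\<dots> \<le> weight K f"
    unfolding weight_def using cmin_le_c[OF assms(1)] assms by (intro sum_mono mult_right_mono) auto
  also have "\<dots> \<le> e K" by fact
  finally have "(\<Sum>i\<in>J. f i) \<le> e K / cmin K" using q by (simp add: field_simps)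
  then have "r * (\<Sum>i\<in>J. f i) \<le> r * (e K / cmin K)" using assms(5) by (rule mult_left_mono)
  then show ?thesis by (simp add: sum_distrib_left)
qed

text \<open>Here \<open>K1\<close> splits off orthogonally, so the weight of the union is that of
  \<open>K1\<close> plus that of a subset of \<open>K2\<close>; each is below half of
  \<open>e (K1 \<union> K2)\<close> by the doubling of the list alone.\<close>

lemma weight_Un_closed:
  assumes K: "K1 \<in> B" "K2 \<in> B" "K1 \<noteq> K1 \<union> K2" "K2 \<noteq> K1 \<union> K2"
    and f: "\<forall>i\<in>K1 \<union> K2. 0 \<le> f i" "weight K1 f \<le> e K1" "weight K2 f \<le> e K2"
    and closed: "closed_in K1 (K1 \<union> K2)"
  shows "weight (K1 \<union> K2) f < e (K1 \<union> K2)"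
proof -
  let ?A = "K1 \<union> K2"
  have A: "?A \<subseteq> \<Delta>" using K B_subset by simp
  have "weight ?A f = weight K1 f + weight (?A - K1) f"
    using weight_closed[OF _ A closed] by simp
  also have "weight (?A - K1) f \<le> weight K2 f"
    using weight_mono[of "?A - K1" K2 f] B_subset[OF K(2)] f(1) by auto
  finally have "weight ?A f \<le> e K1 + e K2" using f by simp
  moreover have "2 * e K1 < e ?A" "2 * e K2 < e ?A"
    using e_double[OF K(1) A] e_double[OF K(2) A] K by (auto simp: psubset_eq)
  ultimately show ?thesis by simp
qed

text \<open>Extend each K to a closed L inside the union. On L the coefficients of the union are
  those of L, so they are bounded by \<open>cmax L\<close>, and the part of the weight over K is
  less than half of \<open>e L\<close>. If one extension is trivial, its K is closed and the
  orthogonal case applies.\<close>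

lemma weight_Un:
  assumes K: "K1 \<in> B" "K2 \<in> B" "K1 \<noteq> K1 \<union> K2" "K2 \<noteq> K1 \<union> K2"
    and f: "\<forall>i\<in>K1 \<union> K2. 0 \<le> f i" "weight K1 f \<le> e K1" "weight K2 f \<le> e K2"
  shows "weight (K1 \<union> K2) f < e (K1 \<union> K2)"
proof -
  let ?A = "K1 \<union> K2"
  have A: "?A \<subseteq> \<Delta>" using K B_subset by simp
  have fin: "finite K1" "finite K2" using K B_finite by auto
  obtain L1 where L1: "L1 \<in> B" "K1 \<subseteq> L1" "L1 \<subseteq> ?A" "closed_in L1 ?A"
    "L1 = K1 \<or> 2 * (cmax L1 / cmin K1) * e K1 < e L1"
    by (rule closed_extension[OF K(1) _ A]) auto
  obtain L2 where L2: "L2 \<in> B" "K2 \<subseteq> L2" "L2 \<subseteq> ?A" "closed_in L2 ?A"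
    "L2 = K2 \<or> 2 * (cmax L2 / cmin K2) * e K2 < e L2"
    by (rule closed_extension[OF K(2) _ A]) auto
  consider "L1 = K1" | "L2 = K2" | "L1 \<noteq> K1" "L2 \<noteq> K2" by blast
  then show ?thesis
  proof cases
    case 1
    then show ?thesis using weight_Un_closed[OF K f] L1 by simp
  next
    case 2
    have eq: "K2 \<union> K1 = K1 \<union> K2" by (rule Un_commute)
    from 2 show ?thesis
      using weight_Un_closed[of K2 K1 f, unfolded eq, OF K(2,1,4,3) f(1,3,2)] L2 by simp
  next
    case 3
    have cA: "c ?A i \<le> cmax L" if "L \<in> B" "L \<subseteq> ?A" "closed_in L ?A" "i \<in> L" for L i
    proof -
      have "c ?A i = c L i"
        using c_closed[OF that(2) A that(3), of i] c_outside[of "?A - L" i] A that(4) by auto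
      also have "\<dots> \<le> cmax L" using c_le_cmax B_subset that by auto
      finally show ?thesis .
    qed
    have cm: "0 \<le> cmax L" if "L \<in> B" for L
      using cmin_le_cmax[OF that B_subset[OF that]] cmin_pos[OF that] by simp
    have "weight ?A f = (\<Sum>i\<in>K1. c ?A i * f i) + (\<Sum>i\<in>K2 - K1. c ?A i * f i)"
      unfolding weight_def using fin by (metis Un_Diff_cancel Diff_disjoint finite_Diff sum.union_disjoint)
    also have "(\<Sum>i\<in>K1. c ?A i * f i) \<le> (\<Sum>i\<in>K1. cmax L1 * f i)"
      using cA[OF L1(1,3,4)] L1(2) f(1) by (intro sum_mono mult_right_mono) auto
    also have "\<dots> \<le> (cmax L1 / cmin K1) * e K1"
      using f cm[OF L1(1)] by (intro sum_le_weight[OF K(1)]) auto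
    also have "(\<Sum>i\<in>K2 - K1. c ?A i * f i) \<le> (\<Sum>i\<in>K2 - K1. cmax L2 * f i)"
      using cA[OF L2(1,3,4)] L2(2) f(1) by (intro sum_mono mult_right_mono) auto
    also have "\<dots> \<le> (cmax L2 / cmin K2) * e K2"
      using f cm[OF L2(1)] by (intro sum_le_weight[OF K(2)]) auto
    finally have "weight ?A f \<le> (cmax L1 / cmin K1) * e K1 + (cmax L2 / cmin K2) * e K2" by simp
    moreover have "2 * ((cmax L1 / cmin K1) * e K1) < e L1" "2 * ((cmax L2 / cmin K2) * e K2) < e L2"
      using L1(5) L2(5) 3 by (simp_all add: mult.assoc)
    moreover have "e L1 \<le> e ?A" "e L2 \<le> e ?A"
      using e_mono[OF L1(1) A L1(3)] e_mono[OF L2(1) A L2(3)] .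
    ultimately show ?thesis by linarith
  qed
qed

text \<open>
  Two members that meet or are not orthogonal are merged into one; once all members are pairwise
  orthogonal, the half-sum of the union is the sum of the half-sums.
\<close>

lemma weight_Union:
  assumes "A \<subseteq> B" "A \<noteq> {}" "\<forall>i\<in>\<Union> A. 0 < f i" "\<forall>K\<in>A. weight K f \<le> e K"
  shows "weight (\<Union> A) f \<le> e (\<Union> A) \<and> (\<Union> A \<notin> A \<longrightarrow> weight (\<Union> A) f < e (\<Union> A))"
  using assms
proof (induction "card A" arbitrary: A rule: less_induct)
  case less
  note A = less.prems
  have finA: "finite A" using A(1) finite_B by (rule finite_subset)
  have sub: "\<Union> A \<subseteq> \<Delta>" using A(1) B_subset by blast
  show ?case
  proof (cases "\<Union> A \<in> A")
    case True
    then show ?thesis using A(4) by simp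
  next
    case notin: False
    show ?thesis
    proof (cases "\<exists>K1\<in>A. \<exists>K2\<in>A. K1 \<noteq> K2 \<and> K1 \<union> K2 \<in> B")
      case True
      then obtain K1 K2 where K: "K1 \<in> A" "K2 \<in> A" "K1 \<noteq> K2" "K1 \<union> K2 \<in> B" by blast
      define M where "M = K1 \<union> K2"
      define A' where "A' = insert M (A - {K1, K2})"
      have UA: "\<Union> A' = \<Union> A" using K by (auto simp: A'_def M_def)
      \<comment> \<open>\<open>K1\<close> and \<open>K2\<close> may be comparable. Then M is one of
        them and merely inherits the weak bound.\<close>
      have pair: "weight M f < e M" if "M \<noteq> K1" "M \<noteq> K2"
        unfolding M_def
      proof (rule weight_Un)
        show "\<forall>i\<in>K1 \<union> K2. 0 \<le> f i" using A(3) K by (auto intro: less_imp_le)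
      qed (use A K that in \<open>auto simp: M_def\<close>)
      then have wM: "weight M f \<le> e M" using A(4) K(1,2) by (metis less_imp_le)
      have "card A' < card A"
      proof -
        have "card (A - {K1, K2}) = card A - 2" using K finA by (simp add: card_Diff_subset)
        moreover have "2 \<le> card A" using K finA card_mono[of A "{K1, K2}"] by simp
        moreover have "card A' \<le> Suc (card (A - {K1, K2}))"
          unfolding A'_def by (rule card_insert_le_m1[of "Suc _", simplified]) simp_all
        ultimately show ?thesis by linarith
      qed
      moreover have "A' \<subseteq> B" using A(1) K(4) by (auto simp: A'_def M_def)
      moreover have "A' \<noteq> {}" by (simp add: A'_def)
      moreover have "\<forall>i\<in>\<Union> A'. 0 < f i" using A(3) by (simp add: UA)
      moreover have "\<forall>K\<in>A'. weight K f \<le> e K" using A(4) wM by (simp add: A'_def)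
      ultimately have IH: "weight (\<Union> A) f \<le> e (\<Union> A) \<and> (\<Union> A \<notin> A' \<longrightarrow> weight (\<Union> A) f < e (\<Union> A))"
        using less.hyps[of A'] unfolding UA by simp
      show ?thesis
      \<comment> \<open>If M is already the whole union, it belongs to the merged family, whose
        induction hypothesis is then not strict; strictness comes from the pair.\<close>
      proof (cases "\<Union> A = M")
        case True
        then have "M \<noteq> K1" "M \<noteq> K2" using notin K(1,2) by auto
        then show ?thesis using pair True by simp
      next
        case False
        then have "\<Union> A \<notin> A'" using notin by (simp add: A'_def)
        then show ?thesis using IH by simp
      qed
    next
      case False
      then have sep: "K1 \<union> K2 \<notin> B" if "K1 \<in> A" "K2 \<in> A" "K1 \<noteq> K2" for K1 K2 using that by blast
      have disj: "K1 \<inter> K2 = {}" if "K1 \<in> A" "K2 \<in> A" "K1 \<noteq> K2" for K1 K2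
        using B_Un[of K1 K2] sep[OF that] A(1) that by auto
      have orth: "i \<bullet> j = 0" if "K1 \<in> A" "K2 \<in> A" "K1 \<noteq> K2" "i \<in> K1" "j \<in> K2" for K1 K2 i j
        using B_join[of K1 K2 i j] sep[OF that(1-3)] A(1) that by auto
      obtain K where K: "K \<in> A" using A(2) by auto
      define U where "U = \<Union> (A - {K})"
      have KB: "K \<in> B" using K A(1) by auto
      have ne: "A - {K} \<noteq> {}"
      proof
        assume "A - {K} = {}"
        then have "A = {K}" using K by blast
        then show False using notin by simp
      qed
      have UK: "\<Union> A - K = U"
      proof
        show "\<Union> A - K \<subseteq> U" by (auto simp: U_def)
        have "U \<inter> K = {}" using disj K by (auto simp: U_def)
        then show "U \<subseteq> \<Union> A - K" by (auto simp: U_def)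
      qed
      have KA: "K \<subseteq> \<Union> A" using K by auto
      have "card (A - {K}) < card A" using finA K by (intro psubset_card_mono) auto
      then have wU: "weight U f \<le> e U"
        using less.hyps[of "A - {K}"] A ne by (auto simp: U_def)
      have "closed_in K (\<Union> A)"
        unfolding closed_in_def UK using orth K by (auto simp: U_def)
      then have "weight (\<Union> A) f = weight K f + weight U f"
        using weight_closed[OF KA sub] by (simp add: UK)
      also have "\<dots> \<le> e K + e U" using A(4) K wU by (simp add: add_mono)
      \<comment> \<open>The remainder U need not belong to B, so the comparison uses cardinalities
        only. This is also why the induction includes unions outside B.\<close>
      also have "\<dots> < e (\<Union> A)"
      proof -
        obtain K' where "K' \<in> A - {K}" using ne by auto
        then have "U \<noteq> {}" using A(1) B_nonempty[of K'] by (auto simp: U_def)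
        moreover have "U \<subseteq> \<Delta>" using sub UK by auto
        moreover have "card (\<Union> A) = card K + card U"
          using card_Un_disjoint[of K U] UK KA finite_subset[OF sub finite_simple]
          by (metis Diff_disjoint Diff_partition finite_Diff finite_subset)
        moreover have "1 \<le> card K" using card_bounds[OF B_subset B_nonempty] KB by simp
        moreover have "card (\<Union> A) \<le> DIM('a)"
          using card_mono[OF finite_simple sub] card_simple by simp
        ultimately show ?thesis
          using eps_add[of "card K" "card U"] card_bounds[of U] by (simp add: e_def)
      qed
      finally show ?thesis by simp
    qed
  qed
qed

lemma nested_polytope_half: "nested_polytope \<Delta> B half c e"
proof -
  interpret finite_building_set \<Delta> B by (rule finite_building_set_B)
  show ?thesis
  proof
    show "independent \<Delta>" "span \<Delta> = UNIV" by (fact indep_simple span_simple)+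
    show "x \<bullet> half J = (\<Sum>i\<in>J. c J i * (x \<bullet> i))" if "J \<in> B" for J x
      using inner_half[OF B_subset[OF that]] .
    show "0 < c J i" if "J \<in> B" "i \<in> J" for J i using c_pos[OF B_subset] that .
    show "0 < e J" if "J \<in> B" for J using e_pos[OF that] .
    show "(\<Sum>i\<in>\<Union> A. c (\<Union> A) i * f i) < e (\<Union> A)"
      if "A \<subseteq> B" "\<Union> A \<in> B" "\<Union> A \<notin> A" "\<forall>i\<in>\<Union> A. 0 < f i"
        "\<forall>K\<in>A. (\<Sum>i\<in>K. c K i * f i) \<le> e K" for A f
    proof -
      have "A \<noteq> {}" using that(2) B_empty by auto
      then show ?thesis using weight_Union[of A f] that unfolding weight_def by simp
    qed
  qed
qed

end

subsection \<open>The realization theorem\<close>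

sublocale root_building_set \<subseteq> poly: nested_polytope \<Delta> B half c e
  by (rule nested_polytope_half)

context root_building_set
begin

section \<open>Translation between sets of simple roots and subspaces\<close>

lemma span_mem_eq_UNIV: "J \<in> B \<Longrightarrow> span J = UNIV \<longleftrightarrow> J = \<Delta>"
  using span_Int_simple[OF B_subset, of J] span_simple by auto

lemma inj_span: "inj_on span B"
proof (rule inj_onI)
  fix J K assume "J \<in> B" "K \<in> B" "span J = span K"
  then show "J = K" using span_Int_simple[OF B_subset] by metis
qed

lemma half_top: "half_sum \<Phi> \<Delta> UNIV = half \<Delta>"
  by (simp add: half_def span_simple)

lemma e_top: "e \<Delta> = a"
  using suitable by (simp add: e_def card_simple suitable_list_def)

lemma delta_span:
  "J \<in> B \<Longrightarrow> delta \<Phi> \<Delta> (span J) = (if J = \<Delta> then half \<Delta> else half \<Delta> - half J)"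
  unfolding delta_def span_mem_eq_UNIV half_top by (simp add: half_def)

lemma face_hyperplane_top: "x \<in> face_hyperplane \<Phi> \<Delta> \<epsilon> a UNIV \<longleftrightarrow> x \<bullet> half \<Delta> = a"
  by (simp add: face_hyperplane_def delta_def half_top)

lemma face_hyperplane_span:
  assumes "J \<in> B" "x \<bullet> half \<Delta> = a"
  shows "x \<in> face_hyperplane \<Phi> \<Delta> \<epsilon> a (span J) \<longleftrightarrow> x \<bullet> half J = e J"
proof (cases "J = \<Delta>")
  case True
  then show ?thesis using assms(2) span_simple by (simp add: face_hyperplane_top e_top)
next
  case False
  then have "span J \<noteq> UNIV" "delta \<Phi> \<Delta> (span J) = half \<Delta> - half J"
    using span_mem_eq_UNIV[OF assms(1)] delta_span[OF assms(1)] by simp_all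
  then show ?thesis
    using assms(2) dim_span_simple[OF B_subset[OF assms(1)]]
    by (auto simp: face_hyperplane_def e_def inner_diff_right)
qed

lemma fund_polytope_eq: "fund_polytope \<Phi> \<Delta> G \<epsilon> a = poly.P"
proof (rule set_eqI)
  fix x
  have fund: "fund \<Delta> G - {UNIV} = span ` (B - {\<Delta>})"
    using span_mem_eq_UNIV by (auto simp: fund_eq)
  have half_space: "x \<in> face_halfspace \<Phi> \<Delta> \<epsilon> a (span J) \<longleftrightarrow> e J \<le> x \<bullet> half J"
    if "x \<bullet> half \<Delta> = a" "J \<in> B - {\<Delta>}" for J
    using that delta_span[of J] dim_span_simple[OF B_subset, of J]
    by (auto simp: face_halfspace_def e_def inner_diff_right)
  have "x \<in> fund_polytope \<Phi> \<Delta> G \<epsilon> a \<longleftrightarrow>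
      x \<bullet> half \<Delta> = a \<and> (\<forall>J\<in>B - {\<Delta>}. x \<in> face_halfspace \<Phi> \<Delta> \<epsilon> a (span J))"
    by (simp add: fund_polytope_def face_hyperplane_top fund)
  also have "\<dots> \<longleftrightarrow> x \<bullet> half \<Delta> = a \<and> (\<forall>J\<in>B - {\<Delta>}. e J \<le> x \<bullet> half J)"
    by (rule conj_cong[OF refl], rule ball_cong[OF refl], rule half_space)
  \<comment> \<open>The added constraint for \<Delta> holds with equality on the top
    hyperplane.\<close>
  also have "\<dots> \<longleftrightarrow> x \<bullet> half \<Delta> = e \<Delta> \<and> (\<forall>J\<in>B. e J \<le> x \<bullet> half J)"
    unfolding e_top by (metis DiffI Diff_iff e_top order_refl singletonD)
  finally show "x \<in> fund_polytope \<Phi> \<Delta> G \<epsilon> a \<longleftrightarrow> x \<in> poly.P"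
    by (simp add: poly.P_def)
qed

text \<open>On B, \<open>span\<close> reflects inclusion and is injective, so antichains and their
  sizes correspond, and the sum of the spans is the span of the union.\<close>

lemma nested_span_iff:
  assumes S: "S \<subseteq> B"
  shows "nested \<Delta> G (span ` S) \<longleftrightarrow> poly.nest S"
proof -
  have eq: "(finite (span ` T) \<and> 2 \<le> card (span ` T) \<and>
      (\<forall>U\<in>span ` T. \<forall>U'\<in>span ` T. U \<subseteq> U' \<longrightarrow> U = U') \<longrightarrow> span (\<Union> (span ` T)) \<notin> G) \<longleftrightarrow>
      (2 \<le> card T \<and> antichain T \<longrightarrow> \<Union> T \<notin> B)" if "T \<subseteq> S" for T
  proof -
    have TB: "T \<subseteq> B" using that S by simp
    have fin: "finite (span ` T)" using finite_subset[OF TB finite_B] by simp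
    have card: "card (span ` T) = card T" using inj_on_subset[OF inj_span TB] by (rule card_image)
    have anti: "(\<forall>U\<in>span ` T. \<forall>U'\<in>span ` T. U \<subseteq> U' \<longrightarrow> U = U') \<longleftrightarrow> antichain T"
      unfolding antichain_def ball_simps
    proof (intro ball_cong refl)
      fix U U' assume "U \<in> T" "U' \<in> T"
      then have "U \<in> B" "U' \<in> B" using TB by auto
      then show "(span U \<subseteq> span U' \<longrightarrow> span U = span U') \<longleftrightarrow> (U \<subseteq> U' \<longrightarrow> U = U')"
        using span_subset_iff[OF B_subset B_subset, of U U'] inj_on_eq_iff[OF inj_span, of U U'] by simp
    qed
    have "span (\<Union> (span ` T)) = span (\<Union> T)"
    proof
      have "\<Union> (span ` T) \<subseteq> span (\<Union> T)" by (intro SUP_least span_mono Union_upper)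
      then show "span (\<Union> (span ` T)) \<subseteq> span (\<Union> T)" by (simp add: span_minimal)
      have "\<Union> T \<subseteq> \<Union> (span ` T)" using span_superset by fastforce
      then show "span (\<Union> T) \<subseteq> span (\<Union> (span ` T))" by (rule span_mono)
    qed
    moreover have "\<Union> T \<subseteq> \<Delta>" using TB B_subset by (intro Union_least) auto
    ultimately have "span (\<Union> (span ` T)) \<in> G \<longleftrightarrow> \<Union> T \<in> B" by (simp add: B_def)
    then show ?thesis by (simp only: fin card anti simp_thms)
  qed
  have all: "(\<forall>T\<subseteq>S. finite (span ` T) \<and> 2 \<le> card (span ` T) \<and>
      (\<forall>U\<in>span ` T. \<forall>U'\<in>span ` T. U \<subseteq> U' \<longrightarrow> U = U') \<longrightarrow> span (\<Union> (span ` T)) \<notin> G) \<longleftrightarrow>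
      (\<forall>T\<subseteq>S. 2 \<le> card T \<and> antichain T \<longrightarrow> \<Union> T \<notin> B)"
    by (intro all_cong1 imp_cong refl eq)
  have "span ` S \<subseteq> fund \<Delta> G" unfolding fund_eq using S by (rule image_mono)
  then show ?thesis
    unfolding nested_def poly.nest_def all_subset_image by (simp only: all S simp_thms)
qed

lemma nested_imp_span:
  assumes "nested \<Delta> G S"
  obtains T where "T \<subseteq> B" "S = span ` T" "poly.nest T"
proof -
  have "S \<subseteq> span ` B" using assms by (simp add: nested_def fund_eq)
  then obtain T where "T \<subseteq> B" "S = span ` T" by (rule subset_imageE)
  then show thesis using that nested_span_iff assms by blast
qed

lemma nest_sub_B: "poly.nest S \<Longrightarrow> S \<subseteq> B"
  by (simp add: poly.nest_def)

lemma span_image_subset_iff: "S \<subseteq> B \<Longrightarrow> T \<subseteq> B \<Longrightarrow> span ` S \<subseteq> span ` T \<longleftrightarrow> S \<subseteq> T"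
  by (rule inj_on_image_subset_iff[OF inj_span])

lemma maximal_nested_iff:
  "maximal_nested \<Delta> G S \<longleftrightarrow> (\<exists>T. poly.max_nest T \<and> S = span ` T)"
proof
  assume S: "maximal_nested \<Delta> G S"
  then obtain T where T: "T \<subseteq> B" "S = span ` T" "poly.nest T"
    using nested_imp_span unfolding maximal_nested_def by metis
  have "R = T" if R: "poly.nest R" "T \<subseteq> R" for R
  proof -
    have "nested \<Delta> G (span ` R)" using nested_span_iff[OF nest_sub_B] R by simp
    moreover have "S \<subseteq> span ` R" using R T by auto
    ultimately have "span ` R = S" using S unfolding maximal_nested_def by metis
    then show ?thesis using span_image_subset_iff[of R T] R T nest_sub_B[of R] by auto
  qed
  then show "\<exists>T. poly.max_nest T \<and> S = span ` T" using T unfolding poly.max_nest_def by metis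
next
  assume "\<exists>T. poly.max_nest T \<and> S = span ` T"
  then obtain T where T: "poly.nest T" "\<And>R. poly.nest R \<Longrightarrow> T \<subseteq> R \<Longrightarrow> R = T" "S = span ` T"
    unfolding poly.max_nest_def by metis
  have TB: "T \<subseteq> B" using T nest_sub_B by simp
  show "maximal_nested \<Delta> G S"
    unfolding maximal_nested_def
  proof (intro conjI allI impI)
    show "nested \<Delta> G S" using T nested_span_iff[OF TB] by simp
    fix R assume "nested \<Delta> G R" "S \<subseteq> R"
    then obtain Q where Q: "Q \<subseteq> B" "R = span ` Q" "poly.nest Q" using nested_imp_span by metis
    then have "T \<subseteq> Q" using \<open>S \<subseteq> R\<close> T(3) span_image_subset_iff[OF TB Q(1)] by simp
    then show "R = S" using T Q by metis
  qed
qed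

text \<open>Membership of \<Delta> puts the top hyperplane into the intersection. On it the other
  hyperplanes become equations for half-sums; off it both sides exclude x.\<close>

lemma hyperplanes_Int:
  assumes "poly.nest S" "\<Delta> \<in> S"
  shows "(\<Inter>A\<in>span ` S. face_hyperplane \<Phi> \<Delta> \<epsilon> a A) = {x. \<forall>J\<in>S. x \<bullet> half J = e J}"
proof (rule set_eqI)
  fix x
  have SB: "S \<subseteq> B" using assms nest_sub_B by simp
  show "x \<in> (\<Inter>A\<in>span ` S. face_hyperplane \<Phi> \<Delta> \<epsilon> a A) \<longleftrightarrow> x \<in> {x. \<forall>J\<in>S. x \<bullet> half J = e J}"
  proof (cases "x \<bullet> half \<Delta> = a")
    case True
    then show ?thesis using face_hyperplane_span SB by auto
  next
    case False
    then have "x \<notin> face_hyperplane \<Phi> \<Delta> \<epsilon> a (span \<Delta>)"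
      using face_hyperplane_top span_simple by simp
    moreover have "x \<bullet> half \<Delta> \<noteq> e \<Delta>" using False e_top by simp
    ultimately show ?thesis using assms(2) by auto
  qed
qed

lemma hyperplane_point_unique:
  assumes "poly.max_nest S"
  shows "{x. \<forall>J\<in>S. x \<bullet> half J = e J} = {hyperplane_point \<Phi> \<Delta> \<epsilon> a (span ` S)}"
proof -
  have "poly.nest S" "\<Delta> \<in> S"
    using assms poly.max_nest_top[OF assms] by (simp_all add: poly.max_nest_def)
  note eq = hyperplanes_Int[OF this]
  obtain x where x: "{x. \<forall>J\<in>S. x \<bullet> half J = e J} = {x}"
    using poly.max_nest_point[OF assms] by (elim ex1E) blast
  then have "hyperplane_point \<Phi> \<Delta> \<epsilon> a (span ` S) = x"
    unfolding hyperplane_point_def eq by simp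
  then show ?thesis using x by simp
qed

text \<open>Since \<open>half J\<close> is the difference of \<open>half \<Delta>\<close> and the
  \<open>delta\<close> vector for \<open>J \<noteq> \<Delta>\<close>, the \<open>delta\<close>
  vectors span. At most n spanning vectors form a basis, and counting them gives
  injectivity.\<close>

lemma delta_independent:
  assumes S: "poly.max_nest S"
  shows "card (span ` S) = DIM('a)" "inj_on (delta \<Phi> \<Delta>) (span ` S)"
    "independent (delta \<Phi> \<Delta> ` span ` S)"
proof -
  have nS: "poly.nest S" using S by (simp add: poly.max_nest_def)
  have SB: "S \<subseteq> B" using nest_sub_B[OF nS] .
  have top: "\<Delta> \<in> S" using poly.max_nest_top[OF S] .
  have fin: "finite S" using poly.finite_nest[OF nS] .
  show card: "card (span ` S) = DIM('a)"
    using card_image[OF inj_on_subset[OF inj_span SB]] poly.card_max_nest_dim[OF S] by simp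
  let ?D = "delta \<Phi> \<Delta> ` span ` S"
  have "half J \<in> span ?D" if "J \<in> S" for J
  proof -
    have base: "delta \<Phi> \<Delta> (span K) \<in> span ?D" if "K \<in> S" for K
      using that by (intro span_base) simp
    have D: "half \<Delta> \<in> span ?D" using base[OF top] delta_span[of \<Delta>] top SB by auto
    show ?thesis
    proof (cases "J = \<Delta>")
      case False
      have "half \<Delta> - delta \<Phi> \<Delta> (span J) \<in> span ?D"
        using D base[OF that] by (rule span_diff)
      then show ?thesis using False delta_span[of J] that SB by auto
    qed (use D in simp)
  qed
  then have "half ` S \<subseteq> span ?D" by auto
  then have "span (half ` S) \<subseteq> span ?D" by (simp add: span_minimal)
  then have sp: "UNIV \<subseteq> span ?D" using poly.span_max_nest[OF S] by simp
  have le: "card ?D \<le> DIM('a)" using card_image_le[of "span ` S" "delta \<Phi> \<Delta>"] fin card by simp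
  show "independent ?D"
    by (rule card_le_dim_spanning[OF _ sp]) (use fin le in auto)
  moreover have "DIM('a) \<le> card ?D"
    using span_card_ge_dim[OF _ sp] fin by simp
  ultimately show "inj_on (delta \<Phi> \<Delta>) (span ` S)"
    using le card fin by (intro eq_card_imp_inj_on) auto
qed

lemma nested_sets_with_top_bij:
  "bij_betw (image span) {S. poly.nest S \<and> \<Delta> \<in> S} (nested_sets_with_top \<Delta> G)"
  unfolding bij_betw_def
proof
  show "inj_on (image span) {S. poly.nest S \<and> \<Delta> \<in> S}"
  proof (rule inj_onI)
    fix S T :: "'a set set"
    assume "S \<in> {S. poly.nest S \<and> \<Delta> \<in> S}" "T \<in> {S. poly.nest S \<and> \<Delta> \<in> S}" "span ` S = span ` T"
    then show "S = T"
      using span_image_subset_iff[of S T] span_image_subset_iff[of T S] nest_sub_B by simp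
  qed
  have top: "UNIV \<in> span ` S \<longleftrightarrow> \<Delta> \<in> S" if "S \<subseteq> B" for S
    using that span_mem_eq_UNIV span_simple by (metis image_iff subsetD)
  show "image span ` {S. poly.nest S \<and> \<Delta> \<in> S} = nested_sets_with_top \<Delta> G"
  proof
    show "image span ` {S. poly.nest S \<and> \<Delta> \<in> S} \<subseteq> nested_sets_with_top \<Delta> G"
      using nested_span_iff[OF nest_sub_B] top[OF nest_sub_B] by (auto simp: nested_sets_with_top_def)
    show "nested_sets_with_top \<Delta> G \<subseteq> image span ` {S. poly.nest S \<and> \<Delta> \<in> S}"
    proof
      fix S assume "S \<in> nested_sets_with_top \<Delta> G"
      then have S: "nested \<Delta> G S" "UNIV \<in> S" by (simp_all add: nested_sets_with_top_def)
      obtain T where T: "T \<subseteq> B" "S = span ` T" "poly.nest T" by (rule nested_imp_span[OF S(1)])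
      then have "\<Delta> \<in> T" using top S(2) by simp
      then show "S \<in> image span ` {S. poly.nest S \<and> \<Delta> \<in> S}" using T by simp
    qed
  qed
qed

text \<open>The bijection is the inverse of \<open>poly.face\<close>, recording the constraints
  tight on a whole face, followed by taking spans.\<close>

lemma face_correspondence:
  obtains \<phi> where "bij_betw \<phi> (nonempty_faces poly.P) (nested_sets_with_top \<Delta> G)"
    "\<And>F F'. F \<in> nonempty_faces poly.P \<Longrightarrow> F' \<in> nonempty_faces poly.P \<Longrightarrow> F \<subseteq> F' \<longleftrightarrow> \<phi> F' \<subseteq> \<phi> F"
    "\<And>F. F \<in> nonempty_faces poly.P \<Longrightarrow> aff_dim F = int (DIM('a)) - int (card (\<phi> F))"
proof -
  let ?N = "{S. poly.nest S \<and> \<Delta> \<in> S}"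
  define \<psi> where "\<psi> = the_inv_into ?N poly.face"
  have \<psi>: "bij_betw \<psi> (nonempty_faces poly.P) ?N"
    unfolding \<psi>_def by (rule bij_betw_the_inv_into[OF poly.face_bij])
  have face: "poly.face (\<psi> F) = F" "poly.nest (\<psi> F)" "\<Delta> \<in> \<psi> F" if "F \<in> nonempty_faces poly.P" for F
    using f_the_inv_into_f_bij_betw[OF poly.face_bij, of F] bij_betwE[OF \<psi>] that
    by (auto simp: \<psi>_def)
  show thesis
  proof (rule that[of "image span \<circ> \<psi>"])
    show "bij_betw (image span \<circ> \<psi>) (nonempty_faces poly.P) (nested_sets_with_top \<Delta> G)"
      using \<psi> nested_sets_with_top_bij by (rule bij_betw_trans)
    fix F assume F: "F \<in> nonempty_faces poly.P"
    have "card (span ` \<psi> F) = card (\<psi> F)"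
      using inj_on_subset[OF inj_span nest_sub_B[OF face(2)[OF F]]] by (rule card_image)
    then show "aff_dim F = int (DIM('a)) - int (card ((image span \<circ> \<psi>) F))"
      using poly.aff_dim_face[OF face(2,3)[OF F]] face(1)[OF F] by simp
    fix F' assume F': "F' \<in> nonempty_faces poly.P"
    show "F \<subseteq> F' \<longleftrightarrow> (image span \<circ> \<psi>) F' \<subseteq> (image span \<circ> \<psi>) F"
      using poly.face_subset_iff[OF face(2,3)[OF F] face(2)[OF F']] face(1)[OF F] face(1)[OF F']
        span_image_subset_iff[OF nest_sub_B[OF face(2)[OF F']] nest_sub_B[OF face(2)[OF F]]]
      by simp
  qed
qed

lemma extreme_points_eq:
  "{x. x extreme_point_of poly.P} =
    {hyperplane_point \<Phi> \<Delta> \<epsilon> a S | S. maximal_nested \<Delta> G S}"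
proof -
  have "x extreme_point_of poly.P \<longleftrightarrow>
      (\<exists>T. poly.max_nest T \<and> x = hyperplane_point \<Phi> \<Delta> \<epsilon> a (span ` T))" for x
    unfolding poly.extreme_points_P
  proof (rule ex_cong1, rule conj_cong[OF refl])
    fix T assume "poly.max_nest T"
    from hyperplane_point_unique[OF this]
    show "(\<forall>A\<in>T. x \<bullet> half A = e A) \<longleftrightarrow> x = hyperplane_point \<Phi> \<Delta> \<epsilon> a (span ` T)" by auto
  qed
  then show ?thesis unfolding maximal_nested_iff by auto
qed

end

theorem theorem3p9:
  fixes \<Phi> \<Delta> :: "'a::euclidean_space set" and G :: "'a set set"
    and \<epsilon> :: "nat \<Rightarrow> real" and a :: real and P :: "'a set"
  assumes "root_system \<Phi>"
    and "simple_roots \<Phi> \<Delta>"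
    and "building_set \<Phi> G"
    and "weyl_invariant \<Phi> G"
    and "UNIV \<in> G"
    and "suitable_list \<Phi> \<Delta> G \<epsilon> a"
    and "P = fund_polytope \<Phi> \<Delta> G \<epsilon> a"
  shows "polytope P \<and>
    (\<exists>\<phi>. bij_betw \<phi> (nonempty_faces P) (nested_sets_with_top \<Delta> G) \<and>
       (\<forall>F\<in>nonempty_faces P. \<forall>F'\<in>nonempty_faces P. F \<subseteq> F' \<longleftrightarrow> \<phi> F' \<subseteq> \<phi> F) \<and>
       (\<forall>F\<in>nonempty_faces P. aff_dim F = int (DIM('a)) - int (card (\<phi> F)))) \<and>
    P \<subseteq> fundamental_chamber \<Delta> \<and>
    (\<forall>S. maximal_nested \<Delta> G S \<longrightarrow>
       UNIV \<in> S \<and> card S = DIM('a) \<and>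
       inj_on (delta \<Phi> \<Delta>) S \<and> independent (delta \<Phi> \<Delta> ` S) \<and>
       (\<Inter>A\<in>S. face_hyperplane \<Phi> \<Delta> \<epsilon> a A) = {hyperplane_point \<Phi> \<Delta> \<epsilon> a S}) \<and>
    {x. x extreme_point_of P} = {hyperplane_point \<Phi> \<Delta> \<epsilon> a S | S. maximal_nested \<Delta> G S}"
proof -
  interpret root_building_set \<Phi> \<Delta> G \<epsilon> a
    using assms by unfold_locales
  have P: "P = poly.P" using assms(7) fund_polytope_eq by simp
  show ?thesis
    unfolding P
  proof (intro conjI allI impI)
    show "polytope poly.P" by (rule poly.polytope_P)
    show "\<exists>\<phi>. bij_betw \<phi> (nonempty_faces poly.P) (nested_sets_with_top \<Delta> G) \<and>
       (\<forall>F\<in>nonempty_faces poly.P. \<forall>F'\<in>nonempty_faces poly.P. F \<subseteq> F' \<longleftrightarrow> \<phi> F' \<subseteq> \<phi> F) \<and>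
       (\<forall>F\<in>nonempty_faces poly.P. aff_dim F = int (DIM('a)) - int (card (\<phi> F)))"
      by (rule face_correspondence) blast
    show "poly.P \<subseteq> fundamental_chamber \<Delta>"
      using poly.P_pos by (auto simp: fundamental_chamber_def)
    show "{x. x extreme_point_of poly.P} = {hyperplane_point \<Phi> \<Delta> \<epsilon> a S | S. maximal_nested \<Delta> G S}"
      by (rule extreme_points_eq)
    fix S assume "maximal_nested \<Delta> G S"
    then obtain T where T: "poly.max_nest T" "S = span ` T" using maximal_nested_iff by auto
    have nT: "poly.nest T" "\<Delta> \<in> T"
      using T(1) poly.max_nest_top[OF T(1)] by (simp_all add: poly.max_nest_def)
    show "UNIV \<in> S" using nT(2) T(2) span_simple by (metis image_eqI)
    show "card S = DIM('a)" "inj_on (delta \<Phi> \<Delta>) S" "independent (delta \<Phi> \<Delta> ` S)"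
      unfolding T(2) by (rule delta_independent[OF T(1)])+
    show "(\<Inter>A\<in>S. face_hyperplane \<Phi> \<Delta> \<epsilon> a A) = {hyperplane_point \<Phi> \<Delta> \<epsilon> a S}"
      unfolding T(2) using hyperplanes_Int[OF nT] hyperplane_point_unique[OF T(1)] by simp
  qed
qed

end
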